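(* The subspace $X_0^{\odot\times}$ is an admissible range for $\{T_0(t)\}_{t\ge 0}$. Moreover, if $\mathscr{X}_0$ is any admissible range for $\{T_0(t)\}_{t\ge0}$, then $\mathscr{X}_0\subseteq X_0^{\odot\times}$.
   Context: All intervals are non-degenerate but otherwise arbitrary. For a Banach space $E$, $\langle x,x^\star\rangle:=x^\star(x)$ for $x\in E$, $x^\star\in E^\star$. Let $\{T_0(t)\}_{t\ge 0}$ be a $\mathcal{C}_0$-semigroup of bounded linear operators with generator $A_0$ on a Banach space $X$ over $\mathbb{K}\in\{\mathbb{R},\mathbb{C}\}$. The sun dual is $X^\odot:=\{x^\star\in X^\star: \lim_{t\downarrow 0}\|T_0(t)^\star x^\star-x^\star\|=0\}$, a norm-closed subspace of $X^\star$ invariant under all $T_0(t)^\star$; $T_0^\odot(t)$ is the restriction of $T_0(t)^\star$ to $X^\odot$ (a $\mathcal{C}_0$-semigroup, with generator $A_0^\odot$); $X^{\odot\star}:=(X^\odot)^\star$, $T_0^{\odot\star}(t):=(T_0^\odot(t))^\star$, $A_0^{\odot\star}:=(A_0^\odot)^\star$. The canonical embedding $j:X\to X^{\odot\star}$ is $\langle x^\odot,jx\rangle:=\langle x,x^\odot\rangle$; it is injective with norm-closed range $jX$. It is not assumed that $X$ is sun-reflexive. A closed subspace $\mathscr{X}_0$ of $X^{\odot\star}$ is an admissible range for $\{T_0(t)\}$ if, for some (equivalently, for every) interval $J$, for every norm-continuous $f:J\to\mathscr{X}_0$ and all $s\le t$ in $J$ the weak$^\star$ integral $\int_s^tT_0^{\odot\star}(t-\tau)f(\tau)\,d\tau$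 belongs to $jX$; here $\langle x^\odot,\int_s^tq(\tau)d\tau\rangle:=\int_s^t\langle x^\odot,q(\tau)\rangle d\tau$ for all $x^\odot\in X^\odot$. For $\lambda\in\rho(A_0)=\rho(A_0^{\odot\star})\subseteq\mathbb{K}$ define $$X_0^{\odot\times}:=\{x^{\odot\star}\in X^{\odot\star}: R(\lambda,A_0^{\odot\star})x^{\odot\star}\in jX\},\qquad R(\lambda,A_0^{\odot\star}):=(\lambda I-A_0^{\odot\star})^{-1}.$$ This closed subspace does not depend on the choice of $\lambda$. *)

theory Defs
  imports "HOL-Analysis.Analysis" "HOL-Library.Function_Algebras"
begin

section \<open>Scalars and Banach spaces over them\<close>

text \<open>
  The scalar field is either the reals or the complex numbers: up to an isometric isomorphism
  these are the only types of the following class.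
\<close>

class real_or_complex = real_normed_field + banach +
  assumes real_or_complex:
    "(\<forall>z. \<exists>a. z = a *\<^sub>R 1) \<or>
     (\<exists>i. i * i = - 1 \<and> (\<forall>z. \<exists>a b. z = a *\<^sub>R 1 + b *\<^sub>R i) \<and>
        (\<forall>a b. norm (a *\<^sub>R 1 + b *\<^sub>R i) = sqrt (a\<^sup>2 + b\<^sup>2)))"

instance real :: real_or_complex
  by standard auto

instance complex :: real_or_complex
proof
  have "\<exists>a b. z = a *\<^sub>R 1 + b *\<^sub>R \<i>" for z :: complex
    by (rule exI[of _ "Re z"], rule exI[of _ "Im z"]) (simp add: complex_eq_iff)
  moreover have "norm (a *\<^sub>R 1 + b *\<^sub>R \<i>) = sqrt (a\<^sup>2 + b\<^sup>2)" for a b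
    by (simp add: cmod_def)
  ultimately show "(\<forall>z::complex. \<exists>a. z = a *\<^sub>R 1) \<or>
     (\<exists>i::complex. i * i = - 1 \<and> (\<forall>z. \<exists>a b. z = a *\<^sub>R 1 + b *\<^sub>R i) \<and>
        (\<forall>a b. norm (a *\<^sub>R 1 + b *\<^sub>R i) = sqrt (a\<^sup>2 + b\<^sup>2)))"
    by (intro disjI2 exI[of _ \<i>]) auto
qed

text \<open>
  A Banach space over \<open>'k\<close> is a real Banach space with a scalar multiplication by \<open>'k\<close>
  which extends the real one and for which the given norm is still homogeneous.
\<close>

locale banach_over = vector_space sc
  for sc :: "'k::real_or_complex \<Rightarrow> 'a::banach \<Rightarrow> 'a" +
  assumes scale_of_real: "sc (of_real r) x = r *\<^sub>R x"
    and norm_scale: "norm (sc c x) = norm c * norm x"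

locale c0_semigroup = banach_over sc
  for sc :: "'k::real_or_complex \<Rightarrow> 'a::banach \<Rightarrow> 'a" +
  fixes T :: "real \<Rightarrow> 'a \<Rightarrow>\<^sub>L 'a"
  assumes T_scale: "0 \<le> t \<Longrightarrow> T t (sc c x) = sc c (T t x)"
    and T_0: "T 0 = id_blinfun"
    and T_add: "0 \<le> s \<Longrightarrow> 0 \<le> t \<Longrightarrow> T (s + t) = T s o\<^sub>L T t"
    and T_strongly_continuous: "((\<lambda>t. T t x) \<longlongrightarrow> x) (at_right 0)"


section \<open>Unbounded operators\<close>

text \<open>
  An unbounded operator on a subspace \<open>V\<close> of the ambient type is represented by its graph.
\<close>

definition generator :: "'e::real_normed_vector set \<Rightarrow> (real \<Rightarrow> 'e \<Rightarrow> 'e) \<Rightarrow> ('e \<times> 'e) set" where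
  "generator V S =
     {(x, y). x \<in> V \<and> y \<in> V \<and> ((\<lambda>h. (S h x - x) /\<^sub>R h) \<longlongrightarrow> y) (at_right 0)}"

definition resolvent :: "('k \<Rightarrow> 'e \<Rightarrow> 'e) \<Rightarrow> ('e::ab_group_add \<times> 'e) set \<Rightarrow> 'k \<Rightarrow> 'e \<Rightarrow> 'e" where
  "resolvent sc A \<mu> y = (THE x. \<exists>z. (x, z) \<in> A \<and> sc \<mu> x - z = y)"

definition resolvent_set ::
    "('k \<Rightarrow> 'e \<Rightarrow> 'e) \<Rightarrow> ('e::real_normed_vector \<times> 'e) set \<Rightarrow> 'k set" where
  "resolvent_set sc A =
     {\<mu>. (\<forall>y. \<exists>!x. \<exists>z. (x, z) \<in> A \<and> sc \<mu> x - z = y) \<and> bounded_linear (resolvent sc A \<mu>)}"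


section \<open>Duals\<close>

text \<open>
  The dual of the whole space lives in the type of real-linear bounded operators into \<open>'k\<close>.
\<close>

definition dual :: "('k::real_or_complex \<Rightarrow> 'a::banach \<Rightarrow> 'a) \<Rightarrow> ('a \<Rightarrow>\<^sub>L 'k) set" where
  "dual sc = {f. \<forall>c x. blinfun_apply f (sc c x) = c * blinfun_apply f x}"

definition dual_scale ::
    "'k::real_normed_field \<Rightarrow> ('a::real_normed_vector \<Rightarrow>\<^sub>L 'k) \<Rightarrow> ('a \<Rightarrow>\<^sub>L 'k)" where
  "dual_scale c f = blinfun_mult_right c o\<^sub>L f"

text \<open>
  The dual of a subspace \<open>V\<close> consists of functions on the ambient type; to make them determined
  by their values on \<open>V\<close>, they are required to vanish off \<open>V\<close>.
\<close>

definition subspace_dual ::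
    "('k::real_normed_field \<Rightarrow> 'e \<Rightarrow> 'e) \<Rightarrow> 'e::real_normed_vector set \<Rightarrow> ('e \<Rightarrow> 'k) set" where
  "subspace_dual sc V =
     {\<phi>. (\<forall>x. x \<notin> V \<longrightarrow> \<phi> x = 0) \<and>
         (\<forall>x\<in>V. \<forall>y\<in>V. \<phi> (x + y) = \<phi> x + \<phi> y) \<and>
         (\<forall>c. \<forall>x\<in>V. \<phi> (sc c x) = c * \<phi> x) \<and>
         (\<exists>M. \<forall>x\<in>V. norm (\<phi> x) \<le> M * norm x)}"

definition subspace_dual_norm ::
    "'e::real_normed_vector set \<Rightarrow> ('e \<Rightarrow> 'k::real_normed_field) \<Rightarrow> real" where
  "subspace_dual_norm V \<phi> = Sup {norm (\<phi> x) |x. x \<in> V \<and> norm x \<le> 1}"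

definition fun_scale :: "'k::times \<Rightarrow> ('e \<Rightarrow> 'k) \<Rightarrow> ('e \<Rightarrow> 'k)" where
  "fun_scale c \<phi> = (\<lambda>x. c * \<phi> x)"

definition adjoint_graph ::
    "('k::real_normed_field \<Rightarrow> 'e \<Rightarrow> 'e) \<Rightarrow> 'e::real_normed_vector set \<Rightarrow> ('e \<times> 'e) set \<Rightarrow>
      (('e \<Rightarrow> 'k) \<times> ('e \<Rightarrow> 'k)) set" where
  "adjoint_graph sc V A =
     {(\<phi>, \<psi>). \<phi> \<in> subspace_dual sc V \<and> \<psi> \<in> subspace_dual sc V \<and> (\<forall>(x, y)\<in>A. \<phi> y = \<psi> x)}"

definition weak_star_integral ::
    "'e set \<Rightarrow> real \<Rightarrow> real \<Rightarrow> (real \<Rightarrow> 'e \<Rightarrow> 'k) \<Rightarrow> ('e \<Rightarrow> 'k::real_normed_field)" where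
  "weak_star_integral V s t q = (\<lambda>x. if x \<in> V then integral {s..t} (\<lambda>\<tau>. q \<tau> x) else 0)"


section \<open>The sun dual and its dual\<close>

definition sun_dual ::
    "('k::real_or_complex \<Rightarrow> 'a::banach \<Rightarrow> 'a) \<Rightarrow> (real \<Rightarrow> 'a \<Rightarrow>\<^sub>L 'a) \<Rightarrow> ('a \<Rightarrow>\<^sub>L 'k) set" where
  "sun_dual sc T =
     {f \<in> dual sc. ((\<lambda>t. norm ((f o\<^sub>L T t) - f)) \<longlongrightarrow> 0) (at_right 0)}"

text \<open>
  This is the adjoint semigroup on the whole dual; it is only used on the sun dual.
\<close>

definition sun_semigroup ::
    "(real \<Rightarrow> 'a::banach \<Rightarrow>\<^sub>L 'a) \<Rightarrow> real \<Rightarrow> ('a \<Rightarrow>\<^sub>L 'k::real_or_complex) \<Rightarrow> ('a \<Rightarrow>\<^sub>L 'k)" where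
  "sun_semigroup T t f = f o\<^sub>L T t"

definition sun_star ::
    "('k::real_or_complex \<Rightarrow> 'a::banach \<Rightarrow> 'a) \<Rightarrow> (real \<Rightarrow> 'a \<Rightarrow>\<^sub>L 'a) \<Rightarrow> (('a \<Rightarrow>\<^sub>L 'k) \<Rightarrow> 'k) set" where
  "sun_star sc T = subspace_dual dual_scale (sun_dual sc T)"

text \<open>
  The locale of metric spaces wants symmetry and nonnegativity of the distance on the whole type,
  and the norm of an unbounded functional is unspecified; hence the conditional.
\<close>

definition sun_star_dist ::
    "('k::real_or_complex \<Rightarrow> 'a::banach \<Rightarrow> 'a) \<Rightarrow> (real \<Rightarrow> 'a \<Rightarrow>\<^sub>L 'a) \<Rightarrow>
      (('a \<Rightarrow>\<^sub>L 'k) \<Rightarrow> 'k) \<Rightarrow> (('a \<Rightarrow>\<^sub>L 'k) \<Rightarrow> 'k) \<Rightarrow> real" where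
  "sun_star_dist sc T \<phi> \<psi> =
     (if \<phi> \<in> sun_star sc T \<and> \<psi> \<in> sun_star sc T
      then subspace_dual_norm (sun_dual sc T) (\<phi> - \<psi>) else 0)"

definition sun_star_topology ::
    "('k::real_or_complex \<Rightarrow> 'a::banach \<Rightarrow> 'a) \<Rightarrow> (real \<Rightarrow> 'a \<Rightarrow>\<^sub>L 'a) \<Rightarrow>
      (('a \<Rightarrow>\<^sub>L 'k) \<Rightarrow> 'k) topology" where
  "sun_star_topology sc T = Metric_space.mtopology (sun_star sc T) (sun_star_dist sc T)"

definition sun_star_semigroup ::
    "('k::real_or_complex \<Rightarrow> 'a::banach \<Rightarrow> 'a) \<Rightarrow> (real \<Rightarrow> 'a \<Rightarrow>\<^sub>L 'a) \<Rightarrow> real \<Rightarrow>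
      (('a \<Rightarrow>\<^sub>L 'k) \<Rightarrow> 'k) \<Rightarrow> (('a \<Rightarrow>\<^sub>L 'k) \<Rightarrow> 'k)" where
  "sun_star_semigroup sc T t \<phi> =
     (\<lambda>f. if f \<in> sun_dual sc T then \<phi> (sun_semigroup T t f) else 0)"

definition sun_star_generator ::
    "('k::real_or_complex \<Rightarrow> 'a::banach \<Rightarrow> 'a) \<Rightarrow> (real \<Rightarrow> 'a \<Rightarrow>\<^sub>L 'a) \<Rightarrow>
      ((('a \<Rightarrow>\<^sub>L 'k) \<Rightarrow> 'k) \<times> (('a \<Rightarrow>\<^sub>L 'k) \<Rightarrow> 'k)) set" where
  "sun_star_generator sc T =
     adjoint_graph dual_scale (sun_dual sc T) (generator (sun_dual sc T) (sun_semigroup T))"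

definition sun_embed ::
    "('k::real_or_complex \<Rightarrow> 'a::banach \<Rightarrow> 'a) \<Rightarrow> (real \<Rightarrow> 'a \<Rightarrow>\<^sub>L 'a) \<Rightarrow> 'a \<Rightarrow> (('a \<Rightarrow>\<^sub>L 'k) \<Rightarrow> 'k)" where
  "sun_embed sc T x = (\<lambda>f. if f \<in> sun_dual sc T then blinfun_apply f x else 0)"

definition sun_cross ::
    "('k::real_or_complex \<Rightarrow> 'a::banach \<Rightarrow> 'a) \<Rightarrow> (real \<Rightarrow> 'a \<Rightarrow>\<^sub>L 'a) \<Rightarrow> 'k \<Rightarrow>
      (('a \<Rightarrow>\<^sub>L 'k) \<Rightarrow> 'k) set" where
  "sun_cross sc T \<mu> =
     {\<phi> \<in> sun_star sc T.
        resolvent fun_scale (sun_star_generator sc T) \<mu> \<phi> \<in> range (sun_embed sc T)}"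


section \<open>Basic facts\<close>

context banach_over
begin

lemma dual_scale_apply: "blinfun_apply (dual_scale c f) x = c * f x"
  by (simp add: dual_scale_def)

lemma zero_mem_dual: "0 \<in> dual sc"
  by (simp add: dual_def)

lemma add_mem_dual: "f \<in> dual sc \<Longrightarrow> g \<in> dual sc \<Longrightarrow> f + g \<in> dual sc"
  by (simp add: dual_def blinfun.add_left algebra_simps)

lemma scale_mem_dual: "f \<in> dual sc \<Longrightarrow> dual_scale c f \<in> dual sc"
  by (simp add: dual_def dual_scale_apply algebra_simps)

end

lemma vector_space_dual_scale:
  "vector_space (dual_scale :: 'k::real_normed_field \<Rightarrow> ('a::real_normed_vector \<Rightarrow>\<^sub>L 'k) \<Rightarrow> _)"
  by standard
    (auto intro!: blinfun_eqI simp: dual_scale_def blinfun.add_left blinfun.add_right algebra_simps)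

lemma vector_space_fun_scale:
  "vector_space (fun_scale :: 'k::field \<Rightarrow> ('e \<Rightarrow> 'k) \<Rightarrow> _)"
  by standard (auto simp: fun_scale_def fun_eq_iff algebra_simps)

lemma norm_dual_scale_le: "norm (dual_scale c f) \<le> norm c * norm f"
  by (rule norm_blinfun_bound)
    (auto simp: dual_scale_def norm_mult mult.assoc intro!: mult_left_mono norm_blinfun)

context c0_semigroup
begin

lemma zero_mem_sun_dual: "0 \<in> sun_dual sc T"
  by (simp add: sun_dual_def zero_mem_dual)

lemma add_mem_sun_dual:
  assumes f: "f \<in> sun_dual sc T" and g: "g \<in> sun_dual sc T"
  shows "f + g \<in> sun_dual sc T"
proof -
  have eq: "((f + g) o\<^sub>L T t) - (f + g) = ((f o\<^sub>L T t) - f) + ((g o\<^sub>L T t) - g)" for t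
    by (rule blinfun_eqI) (simp add: blinfun.add_left blinfun.diff_left)
  have "((\<lambda>t. (f o\<^sub>L T t) - f) \<longlongrightarrow> 0) (at_right 0)" "((\<lambda>t. (g o\<^sub>L T t) - g) \<longlongrightarrow> 0) (at_right 0)"
    using f g by (auto simp: sun_dual_def tendsto_norm_zero_iff)
  from tendsto_add[OF this] show ?thesis
    using f g by (simp add: sun_dual_def eq add_mem_dual tendsto_norm_zero_iff)
qed

lemma scale_mem_sun_dual:
  assumes f: "f \<in> sun_dual sc T"
  shows "dual_scale c f \<in> sun_dual sc T"
proof -
  have eq: "(dual_scale c f o\<^sub>L T t) - dual_scale c f = dual_scale c ((f o\<^sub>L T t) - f)" for t
    by (rule blinfun_eqI) (simp add: dual_scale_apply blinfun.diff_left algebra_simps)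
  have lim: "((\<lambda>t. norm c * norm ((f o\<^sub>L T t) - f)) \<longlongrightarrow> 0) (at_right 0)"
    using f by (intro tendsto_mult_right_zero) (simp add: sun_dual_def)
  have "((\<lambda>t. norm (dual_scale c ((f o\<^sub>L T t) - f))) \<longlongrightarrow> 0) (at_right 0)"
    by (rule tendsto_sandwich[OF _ _ tendsto_const lim]) (auto simp: norm_dual_scale_le)
  then show ?thesis
    using f by (simp add: sun_dual_def scale_mem_dual eq)
qed

lemma scaleR_mem_sun_dual:
  assumes "f \<in> sun_dual sc T"
  shows "r *\<^sub>R f \<in> sun_dual sc T"
proof -
  have "r *\<^sub>R f = dual_scale (of_real r) f"
    by (rule blinfun_eqI) (simp add: dual_scale_apply blinfun.scaleR_left scaleR_conv_of_real)
  then show ?thesis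
    using scale_mem_sun_dual[OF assms] by simp
qed

lemma sun_semigroup_mem_sun_dual:
  assumes f: "f \<in> sun_dual sc T" and t: "0 \<le> t"
  shows "sun_semigroup T t f \<in> sun_dual sc T"
proof -
  have "sun_semigroup T t f \<in> dual sc"
    using f t by (auto simp: sun_dual_def dual_def sun_semigroup_def T_scale)
  moreover have "((\<lambda>h. norm ((sun_semigroup T t f o\<^sub>L T h) - sun_semigroup T t f)) \<longlongrightarrow> 0) (at_right 0)"
  proof (rule tendsto_sandwich[OF _ _ tendsto_const])
    have "((\<lambda>h. norm ((f o\<^sub>L T h) - f)) \<longlongrightarrow> 0) (at_right 0)"
      using f by (simp add: sun_dual_def)
    then show "((\<lambda>h. norm ((f o\<^sub>L T h) - f) * norm (T t)) \<longlongrightarrow> 0) (at_right 0)"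
      by (rule tendsto_mult_left_zero)
    show "\<forall>\<^sub>F h in at_right 0. norm ((sun_semigroup T t f o\<^sub>L T h) - sun_semigroup T t f)
            \<le> norm ((f o\<^sub>L T h) - f) * norm (T t)"
      unfolding eventually_at_right_field
    proof (intro exI[of _ 1] conjI allI impI)
      fix h :: real assume h: "0 < h" "h < 1"
      have comm: "T t o\<^sub>L T h = T h o\<^sub>L T t"
        using T_add[of t h] T_add[of h t] t h by (simp add: add.commute)
      have "T t (T h x) = T h (T t x)" for x
        using arg_cong[OF comm, of "\<lambda>S. blinfun_apply S x"] by simp
      then have "(sun_semigroup T t f o\<^sub>L T h) - sun_semigroup T t f = ((f o\<^sub>L T h) - f) o\<^sub>L T t"
        by (intro blinfun_eqI) (simp add: sun_semigroup_def blinfun.diff_left)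
      then show "norm ((sun_semigroup T t f o\<^sub>L T h) - sun_semigroup T t f)
            \<le> norm ((f o\<^sub>L T h) - f) * norm (T t)"
        by (simp add: norm_blinfun_compose)
    qed simp
  qed auto
  ultimately show ?thesis
    by (simp add: sun_dual_def)
qed

end


section \<open>Admissible ranges\<close>

definition admissible_on ::
    "('k::real_or_complex \<Rightarrow> 'a::banach \<Rightarrow> 'a) \<Rightarrow> (real \<Rightarrow> 'a \<Rightarrow>\<^sub>L 'a) \<Rightarrow> real set \<Rightarrow>
      (('a \<Rightarrow>\<^sub>L 'k) \<Rightarrow> 'k) set \<Rightarrow> bool" where
  "admissible_on sc T J W \<longleftrightarrow>
     (\<forall>f. continuous_map (top_of_set J) (sun_star_topology sc T) f \<and> f ` J \<subseteq> W \<longrightarrow>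
        (\<forall>s\<in>J. \<forall>t\<in>J. s \<le> t \<longrightarrow>
           weak_star_integral (sun_dual sc T) s t
             (\<lambda>\<tau>. sun_star_semigroup sc T (t - \<tau>) (f \<tau>)) \<in> range (sun_embed sc T)))"

definition nondegenerate_interval :: "real set \<Rightarrow> bool" where
  "nondegenerate_interval J \<longleftrightarrow> is_interval J \<and> (\<exists>a\<in>J. \<exists>b\<in>J. a < b)"

text \<open>
  Some interval or every interval: both give the same notion, see \<open>admissible_range_iff\<close> below.
\<close>

definition admissible_range ::
    "('k::real_or_complex \<Rightarrow> 'a::banach \<Rightarrow> 'a) \<Rightarrow> (real \<Rightarrow> 'a \<Rightarrow>\<^sub>L 'a) \<Rightarrow>
      (('a \<Rightarrow>\<^sub>L 'k) \<Rightarrow> 'k) set \<Rightarrow> bool" where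
  "admissible_range sc T W \<longleftrightarrow>
     closedin (sun_star_topology sc T) W \<and> module.subspace fun_scale W \<and>
     (\<exists>J. nondegenerate_interval J \<and> admissible_on sc T J W)"

section \<open>The choice of the interval is immaterial\<close>

lemma uniform_boundedness:
  fixes S :: "nat \<Rightarrow> 'a::banach \<Rightarrow>\<^sub>L 'b::real_normed_vector"
  assumes bdd: "\<And>x. \<exists>M. \<forall>n. norm (S n x) \<le> M"
  shows "\<exists>M. \<forall>n. norm (S n) \<le> M"
proof -
  define F where "F k = {x. \<forall>n. norm (S n x) \<le> real k}" for k :: nat
  have closed: "closed (F k)" for k
    unfolding F_def by (intro closed_Collect_all closed_Collect_le continuous_intros)
  have "\<exists>k. x \<in> F k" for x
  proof -
    obtain M where M: "\<forall>n. norm (S n x) \<le> M"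
      using bdd by blast
    obtain k where "M \<le> real k"
      using real_arch_simple by blast
    with M show ?thesis
      unfolding F_def by (auto intro: order_trans)
  qed
  then have UN: "\<Union>(range F) = UNIV"
    by blast
  have "\<exists>k. interior (F k) \<noteq> {}"
  proof (rule ccontr)
    assume "\<not> ?thesis"
    then have "Met_TC.mtopology interior_of \<Union>(range F) = {}"
      by (intro Met_TC.metric_Baire_category_alt)
        (auto simp: closed complete_UNIV interior_of_def interior_def)
    then show False
      by (simp add: UN)
  qed
  then obtain k x0 where "x0 \<in> interior (F k)"
    by blast
  then obtain r where r: "r > 0" "cball x0 r \<subseteq> F k"
    using mem_interior_cball by blast
  have small: "norm (S n y) \<le> 2 * real k" if "norm y \<le> r" for n y
  proof -
    have "x0 + y \<in> F k" "x0 \<in> F k"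
      using r that by (auto simp: subset_iff dist_norm)
    then have "norm (S n (x0 + y)) \<le> k" "norm (S n x0) \<le> k"
      by (auto simp: F_def)
    moreover have "norm (S n y) \<le> norm (S n (x0 + y)) + norm (S n x0)"
      using norm_triangle_ineq4[of "S n (x0 + y)" "S n x0"] by (simp add: blinfun.add_right)
    ultimately show ?thesis
      by simp
  qed
  have "norm (S n) \<le> 2 * real k / r" for n
  proof (rule norm_blinfun_bound)
    show "norm (S n y) \<le> 2 * real k / r * norm y" for y
    proof (cases "y = 0")
      case False
      then have "norm (S n ((r / norm y) *\<^sub>R y)) \<le> 2 * real k"
        using r by (intro small) simp
      then show ?thesis
        using False r by (simp add: blinfun.scaleR_right field_simps)
    qed simp
  qed (use r in simp)
  then show ?thesis
    by blast
qed

context c0_semigroup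
begin

lemma locally_bounded: "\<exists>d>0. \<exists>M. \<forall>t\<in>{0..d}. norm (T t) \<le> M"
proof (rule ccontr)
  assume contra: "\<not> ?thesis"
  have "\<exists>t\<in>{0..inverse (real (Suc n))}. norm (T t) > real n" for n
  proof -
    have "0 < inverse (real (Suc n))"
      by simp
    then have "\<not> (\<forall>t\<in>{0..inverse (real (Suc n))}. norm (T t) \<le> real n)"
      using contra by blast
    then show ?thesis
      by (simp add: not_le Bex_def)
  qed
  then obtain \<tau> where \<tau>: "\<And>n. \<tau> n \<in> {0..inverse (real (Suc n))}" "\<And>n. norm (T (\<tau> n)) > real n"
    by metis
  have lim: "\<tau> \<longlonglongrightarrow> 0"
    by (rule tendsto_sandwich[OF _ _ tendsto_const LIMSEQ_inverse_real_of_nat])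
      (use \<tau>(1) in auto)
  have "\<exists>M. \<forall>n. norm (T (\<tau> n) x) \<le> M" for x
  proof -
    have "continuous (at 0 within {0..}) (\<lambda>t. T t x)"
      using T_strongly_continuous[of x]
      by (simp add: continuous_within T_0 at_within_Ici_at_right)
    then have "(\<lambda>n. T (\<tau> n) x) \<longlonglongrightarrow> T 0 x"
      using lim \<tau>(1) by (auto simp: continuous_within_sequentially o_def)
    then have "Bseq (\<lambda>n. T (\<tau> n) x)"
      by (intro convergent_imp_Bseq convergentI)
    then show ?thesis
      unfolding Bseq_def by blast
  qed
  from uniform_boundedness[OF this] obtain M where M: "\<And>n. norm (T (\<tau> n)) \<le> M"
    by blast
  obtain n where "M \<le> real n"
    using real_arch_simple by blast
  with M[of n] \<tau>(2)[of n] show False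
    by simp
qed

lemma bounded_on_compact: "\<exists>M>0. \<forall>t\<in>{0..b}. norm (T t) \<le> M"
proof -
  obtain d K where d: "d > 0" and K: "\<And>t. t \<in> {0..d} \<Longrightarrow> norm (T t) \<le> K"
    using locally_bounded by blast
  have "\<exists>M>0. \<forall>t\<in>{0..real n * d}. norm (T t) \<le> M" for n
  proof (induction n)
    case 0
    show ?case
      by (rule exI[of _ "norm (T 0) + 1"]) (auto simp: add_nonneg_pos)
  next
    case (Suc n)
    then obtain M where M: "M > 0" "\<And>t. t \<in> {0..real n * d} \<Longrightarrow> norm (T t) \<le> M"
      by blast
    have "norm (T t) \<le> max M (M * K)" if t: "t \<in> {0..real (Suc n) * d}" for t
    proof (cases "t \<le> real n * d")
      case True
      then show ?thesis
        using M t by (simp add: le_max_iff_disj)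
    next
      case False
      define u where "u = real n * d"
      have u: "u \<ge> 0" "u \<le> real n * d"
        using d by (auto simp: u_def)
      have "T t = T u o\<^sub>L T (t - u)"
        using T_add[of u "t - u"] u False by simp
      also have "norm \<dots> \<le> norm (T u) * norm (T (t - u))"
        by (rule norm_blinfun_compose)
      also have "\<dots> \<le> M * K"
        using False t u d M K by (intro mult_mono) (auto simp: u_def algebra_simps)
      finally show ?thesis
        by simp
    qed
    moreover have "max M (M * K) > 0"
      using M by simp
    ultimately show ?case
      by blast
  qed
  moreover obtain n where "b \<le> real n * d"
    using d reals_Archimedean3 less_imp_le by blast
  ultimately obtain M where "M > 0" "\<forall>t\<in>{0..real n * d}. norm (T t) \<le> M"
    by blast
  then show ?thesis
    using \<open>b \<le> real n * d\<close> by (intro exI[of _ M]) auto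
qed

lemma sun_semigroup_diff_le:
  assumes "0 \<le> a" "a \<le> b"
  shows "norm (sun_semigroup T b f - sun_semigroup T a f) \<le> norm ((f o\<^sub>L T (b - a)) - f) * norm (T a)"
proof -
  have "T b = T (b - a) o\<^sub>L T a"
    using T_add[of "b - a" a] assms by simp
  then have "sun_semigroup T b f - sun_semigroup T a f = ((f o\<^sub>L T (b - a)) - f) o\<^sub>L T a"
    by (intro blinfun_eqI) (simp add: sun_semigroup_def blinfun.diff_left)
  then show ?thesis
    by (simp add: norm_blinfun_compose)
qed

lemma continuous_on_sun_semigroup:
  assumes f: "f \<in> sun_dual sc T"
  shows "continuous_on {0..} (\<lambda>t. sun_semigroup T t f)"
  unfolding continuous_on_iff
proof (intro ballI allI impI)
  fix t0 e :: real assume t0: "t0 \<in> {0..}" and e: "0 < e"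
  obtain B where B: "B > 0" "\<And>t. t \<in> {0..t0 + 1} \<Longrightarrow> norm (T t) \<le> B"
    using bounded_on_compact by blast
  have "\<forall>\<^sub>F h in at_right 0. norm ((f o\<^sub>L T h) - f) < e / B"
    using f e B by (intro order_tendstoD) (auto simp: sun_dual_def)
  then obtain d where d: "d > 0" "\<And>h. 0 < h \<Longrightarrow> h < d \<Longrightarrow> norm ((f o\<^sub>L T h) - f) < e / B"
    unfolding eventually_at_right_field by auto
  have *: "norm (sun_semigroup T b f - sun_semigroup T a f) < e"
    if "0 \<le> a" "a < b" "b - a < d" "a \<le> t0 + 1" for a b
  proof -
    have "norm ((f o\<^sub>L T (b - a)) - f) * norm (T a) \<le> norm ((f o\<^sub>L T (b - a)) - f) * B"
      using that B by (intro mult_left_mono) auto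
    also have "\<dots> < e"
      using d(2)[of "b - a"] that B by (simp add: field_simps)
    finally show ?thesis
      using sun_semigroup_diff_le[of a b f] that by simp
  qed
  show "\<exists>d>0. \<forall>t\<in>{0..}. dist t t0 < d \<longrightarrow> dist (sun_semigroup T t f) (sun_semigroup T t0 f) < e"
  proof (intro exI[of _ "min d 1"] conjI ballI impI)
    fix t :: real assume t: "t \<in> {0..}" "dist t t0 < min d 1"
    consider "t < t0" | "t = t0" | "t0 < t"
      by linarith
    then show "dist (sun_semigroup T t f) (sun_semigroup T t0 f) < e"
      using *[of t t0] *[of t0 t] t t0 e
      by cases (auto simp: dist_norm norm_minus_commute)
  qed (use d in auto)
qed

lemma
  assumes "\<phi> \<in> sun_star sc T"
  shows sun_star_off: "f \<notin> sun_dual sc T \<Longrightarrow> \<phi> f = 0"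
    and sun_star_add: "f \<in> sun_dual sc T \<Longrightarrow> g \<in> sun_dual sc T \<Longrightarrow> \<phi> (f + g) = \<phi> f + \<phi> g"
    and sun_star_scale: "f \<in> sun_dual sc T \<Longrightarrow> \<phi> (dual_scale c f) = c * \<phi> f"
    and sun_star_bound: "\<exists>M. \<forall>f\<in>sun_dual sc T. norm (\<phi> f) \<le> M * norm f"
  using assms by (auto simp: sun_star_def subspace_dual_def)

lemma sun_star_scaleR:
  assumes "\<phi> \<in> sun_star sc T" "f \<in> sun_dual sc T"
  shows "\<phi> (r *\<^sub>R f) = r *\<^sub>R \<phi> f"
proof -
  have "r *\<^sub>R f = dual_scale (of_real r) f"
    by (rule blinfun_eqI) (simp add: dual_scale_apply blinfun.scaleR_left scaleR_conv_of_real)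
  then show ?thesis
    using sun_star_scale[OF assms] by (simp add: scaleR_conv_of_real)
qed

lemma sun_star_minus:
  assumes "\<phi> \<in> sun_star sc T" "f \<in> sun_dual sc T" "g \<in> sun_dual sc T"
  shows "\<phi> (f - g) = \<phi> f - \<phi> g"
  using sun_star_add[OF assms(1,2) scaleR_mem_sun_dual[OF assms(3), of "-1"]]
    sun_star_scaleR[OF assms(1,3), of "-1"] by simp

lemma sun_star_diff_mem:
  assumes "\<phi> \<in> sun_star sc T" "\<psi> \<in> sun_star sc T"
  shows "\<phi> - \<psi> \<in> sun_star sc T"
proof -
  obtain M N where "\<And>f. f \<in> sun_dual sc T \<Longrightarrow> norm (\<phi> f) \<le> M * norm f"
    "\<And>f. f \<in> sun_dual sc T \<Longrightarrow> norm (\<psi> f) \<le> N * norm f"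
    using sun_star_bound assms by metis
  then have "\<forall>f\<in>sun_dual sc T. norm ((\<phi> - \<psi>) f) \<le> (M + N) * norm f"
    by (auto simp: algebra_simps intro!: order_trans[OF norm_triangle_ineq4] add_mono)
  then have "\<exists>M. \<forall>f\<in>sun_dual sc T. norm ((\<phi> - \<psi>) f) \<le> M * norm f"
    by blast
  moreover have "\<forall>x. x \<notin> sun_dual sc T \<longrightarrow> (\<phi> - \<psi>) x = 0"
    "\<forall>x\<in>sun_dual sc T. \<forall>y\<in>sun_dual sc T. (\<phi> - \<psi>) (x + y) = (\<phi> - \<psi>) x + (\<phi> - \<psi>) y"
    "\<forall>c. \<forall>x\<in>sun_dual sc T. (\<phi> - \<psi>) (dual_scale c x) = c * (\<phi> - \<psi>) x"
    using assms by (auto simp: sun_star_off sun_star_add sun_star_scale algebra_simps)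
  ultimately show ?thesis
    unfolding sun_star_def subspace_dual_def by blast
qed

lemma norm_sun_star_le_Sup:
  assumes \<phi>: "\<phi> \<in> sun_star sc T" and f: "f \<in> sun_dual sc T" "norm f \<le> 1"
  shows "norm (\<phi> f) \<le> subspace_dual_norm (sun_dual sc T) \<phi>"
  unfolding subspace_dual_norm_def
proof (rule cSup_upper)
  obtain M where M: "\<And>f. f \<in> sun_dual sc T \<Longrightarrow> norm (\<phi> f) \<le> M * norm f"
    using sun_star_bound[OF \<phi>] by blast
  have "norm (\<phi> g) \<le> \<bar>M\<bar>" if "g \<in> sun_dual sc T" "norm g \<le> 1" for g
  proof -
    have "M * norm g \<le> \<bar>M\<bar> * 1"
      using that by (intro mult_mono) auto
    with M[OF that(1)] show ?thesis
      by simp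
  qed
  then show "bdd_above {norm (\<phi> x) |x. x \<in> sun_dual sc T \<and> norm x \<le> 1}"
    by (intro bdd_aboveI[of _ "\<bar>M\<bar>"]) auto
qed (use f in blast)

lemma norm_sun_star_le:
  assumes \<phi>: "\<phi> \<in> sun_star sc T" and f: "f \<in> sun_dual sc T"
  shows "norm (\<phi> f) \<le> subspace_dual_norm (sun_dual sc T) \<phi> * norm f"
proof (cases "f = 0")
  case True
  then show ?thesis
    using sun_star_scaleR[OF \<phi> f, of 0] by simp
next
  case False
  have "norm (\<phi> (inverse (norm f) *\<^sub>R f)) \<le> subspace_dual_norm (sun_dual sc T) \<phi>"
    using False f by (intro norm_sun_star_le_Sup \<phi> scaleR_mem_sun_dual) auto
  then show ?thesis
    using False by (simp add: sun_star_scaleR[OF \<phi> f] field_simps)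
qed

lemma sun_star_norm_nonneg: "\<phi> \<in> sun_star sc T \<Longrightarrow> 0 \<le> subspace_dual_norm (sun_dual sc T) \<phi>"
  using norm_sun_star_le_Sup[of \<phi> 0] zero_mem_sun_dual norm_ge_zero[of "\<phi> 0"]
  by (simp del: norm_ge_zero)

lemma sun_star_norm_leI:
  assumes "\<And>f. f \<in> sun_dual sc T \<Longrightarrow> norm f \<le> 1 \<Longrightarrow> norm (\<phi> f) \<le> K"
  shows "subspace_dual_norm (sun_dual sc T) \<phi> \<le> K"
  unfolding subspace_dual_norm_def
proof (rule cSup_least)
  show "{norm (\<phi> x) |x. x \<in> sun_dual sc T \<and> norm x \<le> 1} \<noteq> {}"
    using zero_mem_sun_dual by force
qed (use assms in blast)

lemma Metric_space_sun_star: "Metric_space (sun_star sc T) (sun_star_dist sc T)"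
proof
  fix \<phi> \<psi> :: "('a \<Rightarrow>\<^sub>L 'k) \<Rightarrow> 'k"
  show "0 \<le> sun_star_dist sc T \<phi> \<psi>"
    by (simp add: sun_star_dist_def sun_star_norm_nonneg sun_star_diff_mem)
  show "sun_star_dist sc T \<phi> \<psi> = sun_star_dist sc T \<psi> \<phi>"
    by (simp add: sun_star_dist_def subspace_dual_norm_def norm_minus_commute)
  assume mem: "\<phi> \<in> sun_star sc T" "\<psi> \<in> sun_star sc T"
  show "sun_star_dist sc T \<phi> \<psi> = 0 \<longleftrightarrow> \<phi> = \<psi>"
  proof
    assume "sun_star_dist sc T \<phi> \<psi> = 0"
    then have "\<phi> f = \<psi> f" for f
      using norm_sun_star_le[OF sun_star_diff_mem[OF mem], of f] sun_star_off[OF mem(1), of f]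
        sun_star_off[OF mem(2), of f] mem by (cases "f \<in> sun_dual sc T") (auto simp: sun_star_dist_def)
    then show "\<phi> = \<psi>"
      by (rule ext)
  next
    assume "\<phi> = \<psi>"
    then have "subspace_dual_norm (sun_dual sc T) (\<phi> - \<psi>) \<le> 0"
      by (intro sun_star_norm_leI) simp
    then show "sun_star_dist sc T \<phi> \<psi> = 0"
      using sun_star_norm_nonneg[OF sun_star_diff_mem[OF mem]] mem by (simp add: sun_star_dist_def)
  qed
next
  fix \<phi> \<psi> \<xi> :: "('a \<Rightarrow>\<^sub>L 'k) \<Rightarrow> 'k"
  assume mem: "\<phi> \<in> sun_star sc T" "\<psi> \<in> sun_star sc T" "\<xi> \<in> sun_star sc T"
  have "subspace_dual_norm (sun_dual sc T) (\<phi> - \<xi>)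
      \<le> subspace_dual_norm (sun_dual sc T) (\<phi> - \<psi>) + subspace_dual_norm (sun_dual sc T) (\<psi> - \<xi>)"
  proof (rule sun_star_norm_leI)
    fix f :: "'a \<Rightarrow>\<^sub>L 'k" assume f: "f \<in> sun_dual sc T" "norm f \<le> 1"
    have "norm ((\<phi> - \<xi>) f) \<le> norm ((\<phi> - \<psi>) f) + norm ((\<psi> - \<xi>) f)"
      using norm_triangle_ineq[of "(\<phi> - \<psi>) f" "(\<psi> - \<xi>) f"] by simp
    also have "\<dots> \<le> subspace_dual_norm (sun_dual sc T) (\<phi> - \<psi>) + subspace_dual_norm (sun_dual sc T) (\<psi> - \<xi>)"
      using f mem by (intro add_mono norm_sun_star_le_Sup sun_star_diff_mem)
    finally show "norm ((\<phi> - \<xi>) f)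
        \<le> subspace_dual_norm (sun_dual sc T) (\<phi> - \<psi>) + subspace_dual_norm (sun_dual sc T) (\<psi> - \<xi>)" .
  qed
  then show "sun_star_dist sc T \<phi> \<xi> \<le> sun_star_dist sc T \<phi> \<psi> + sun_star_dist sc T \<psi> \<xi>"
    using mem by (simp add: sun_star_dist_def)
qed

lemma continuous_map_sun_starD:
  fixes J :: "real set"
  assumes "continuous_map (top_of_set J) (sun_star_topology sc T) f"
  shows "x \<in> J \<Longrightarrow> f x \<in> sun_star sc T"
    and "x \<in> J \<Longrightarrow> 0 < e \<Longrightarrow>
      \<exists>d>0. \<forall>y\<in>J. \<bar>y - x\<bar> < d \<longrightarrow> subspace_dual_norm (sun_dual sc T) (f x - f y) < e"
proof -
  interpret S: Metric_space "sun_star sc T" "sun_star_dist sc T"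
    by (rule Metric_space_sun_star)
  have "f \<in> J \<rightarrow> sun_star sc T"
    using continuous_map_funspace[OF assms] by (simp add: sun_star_topology_def)
  then show "x \<in> J \<Longrightarrow> f x \<in> sun_star sc T"
    by (rule funcset_mem)
  assume x: "x \<in> J" and e: "0 < e"
  have "\<forall>x\<in>J. \<forall>e>0. \<exists>U. openin (top_of_set J) U \<and> x \<in> U \<and> (\<forall>y\<in>U. f y \<in> S.mball (f x) e)"
    using assms unfolding sun_star_topology_def S.continuous_map_to_metric by simp
  then have "\<exists>U. openin (top_of_set J) U \<and> x \<in> U \<and> (\<forall>y\<in>U. f y \<in> S.mball (f x) e)"
    using x e by simp
  then obtain U where U: "openin (top_of_set J) U" "x \<in> U" "\<forall>y\<in>U. f y \<in> S.mball (f x) e"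
    by (elim exE conjE)
  have "\<exists>d>0. \<forall>y\<in>J. dist y x < d \<longrightarrow> y \<in> U"
    using U(1,2) unfolding openin_euclidean_subtopology_iff by simp
  then obtain d where d: "d > 0" "\<And>y. y \<in> J \<Longrightarrow> dist y x < d \<Longrightarrow> y \<in> U"
    by blast
  show "\<exists>d>0. \<forall>y\<in>J. \<bar>y - x\<bar> < d \<longrightarrow> subspace_dual_norm (sun_dual sc T) (f x - f y) < e"
  proof (intro exI[of _ d] conjI ballI impI)
    fix y assume "y \<in> J" "\<bar>y - x\<bar> < d"
    then have "y \<in> U"
      using d(2) by (simp add: dist_real_def)
    with U(3) have "f y \<in> S.mball (f x) e" ..
    then show "subspace_dual_norm (sun_dual sc T) (f x - f y) < e"
      by (auto simp: sun_star_dist_def)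
  qed (use d in simp)
qed

lemma continuous_on_integrand:
  assumes f: "continuous_map (top_of_set J) (sun_star_topology sc T) f"
    and J: "{s..t} \<subseteq> J" and x: "x \<in> sun_dual sc T"
  shows "continuous_on {s..t} (\<lambda>\<tau>. f \<tau> (sun_semigroup T (t - \<tau>) x))"
  unfolding continuous_on_def
proof
  fix \<tau> assume \<tau>: "\<tau> \<in> {s..t}"
  let ?N = "subspace_dual_norm (sun_dual sc T)"
  let ?u = "\<lambda>\<sigma>. sun_semigroup T (t - \<sigma>) x"
  have u: "continuous_on {s..t} ?u"
    by (rule continuous_on_compose2[OF continuous_on_sun_semigroup[OF x]
          continuous_on_diff[OF continuous_on_const continuous_on_id]]) auto
  then have u_lim: "(?u \<longlongrightarrow> ?u \<tau>) (at \<tau> within {s..t})"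
    using \<tau> by (simp add: continuous_on_def)
  have mem: "?u \<sigma> \<in> sun_dual sc T" "f \<sigma> \<in> sun_star sc T" if "\<sigma> \<in> {s..t}" for \<sigma>
    using that x J continuous_map_sun_starD(1)[OF f, of \<sigma>]
    by (auto intro!: sun_semigroup_mem_sun_dual)
  have N_lim: "((\<lambda>\<sigma>. ?N (f \<tau> - f \<sigma>)) \<longlongrightarrow> 0) (at \<tau> within {s..t})"
  proof (rule tendstoI)
    fix e :: real assume "0 < e"
    then obtain d where "d > 0" "\<forall>y\<in>J. \<bar>y - \<tau>\<bar> < d \<longrightarrow> ?N (f \<tau> - f y) < e"
      using continuous_map_sun_starD(2)[OF f, of \<tau> e] J \<tau> by blast
    then show "\<forall>\<^sub>F \<sigma> in at \<tau> within {s..t}. dist (?N (f \<tau> - f \<sigma>)) 0 < e"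
      using J mem \<tau> unfolding eventually_at
      by (intro exI[of _ d]) (auto simp: dist_real_def sun_star_norm_nonneg sun_star_diff_mem)
  qed
  have lim: "((\<lambda>\<sigma>. ?N (f \<tau> - f \<sigma>) * norm (?u \<sigma>) + ?N (f \<tau>) * norm (?u \<sigma> - ?u \<tau>)) \<longlongrightarrow> 0)
      (at \<tau> within {s..t})"
    using tendsto_add[OF tendsto_mult[OF N_lim tendsto_norm[OF u_lim]]
        tendsto_mult[OF tendsto_const[of "?N (f \<tau>)"] tendsto_norm[OF LIM_zero[OF u_lim]]]]
    by simp
  show "((\<lambda>\<sigma>. f \<sigma> (?u \<sigma>)) \<longlongrightarrow> f \<tau> (?u \<tau>)) (at \<tau> within {s..t})"
  proof (rule LIM_zero_cancel, rule Lim_null_comparison[OF _ lim])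
    have "norm (f \<sigma> (?u \<sigma>) - f \<tau> (?u \<tau>))
        \<le> ?N (f \<tau> - f \<sigma>) * norm (?u \<sigma>) + ?N (f \<tau>) * norm (?u \<sigma> - ?u \<tau>)" if \<sigma>: "\<sigma> \<in> {s..t}" for \<sigma>
    proof -
      have "f \<sigma> (?u \<sigma>) - f \<tau> (?u \<tau>) = f \<tau> (?u \<sigma> - ?u \<tau>) - (f \<tau> - f \<sigma>) (?u \<sigma>)"
        using sun_star_minus[OF mem(2)[OF \<tau>] mem(1)[OF \<sigma>] mem(1)[OF \<tau>]] by simp
      also have "norm \<dots> \<le> norm ((f \<tau> - f \<sigma>) (?u \<sigma>)) + norm (f \<tau> (?u \<sigma> - ?u \<tau>))"
        using norm_triangle_ineq4[of "f \<tau> (?u \<sigma> - ?u \<tau>)" "(f \<tau> - f \<sigma>) (?u \<sigma>)"]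
        by (simp add: add.commute)
      also have "\<dots> \<le> ?N (f \<tau> - f \<sigma>) * norm (?u \<sigma>) + ?N (f \<tau>) * norm (?u \<sigma> - ?u \<tau>)"
        using mem \<tau> \<sigma> add_mem_sun_dual[OF mem(1)[OF \<sigma>] scaleR_mem_sun_dual[OF mem(1)[OF \<tau>], of "-1"]]
        by (intro add_mono norm_sun_star_le sun_star_diff_mem) auto
      finally show ?thesis .
    qed
    then show "\<forall>\<^sub>F \<sigma> in at \<tau> within {s..t}. norm (f \<sigma> (?u \<sigma>) - f \<tau> (?u \<tau>))
        \<le> ?N (f \<tau> - f \<sigma>) * norm (?u \<sigma>) + ?N (f \<tau>) * norm (?u \<sigma> - ?u \<tau>)"
      by (auto simp: eventually_at_filter)
  qed
qed

lemma admissible_on_change_interval: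
  assumes J: "nondegenerate_interval J" and J': "nondegenerate_interval J'"
    and adm: "admissible_on sc T J W"
  shows "admissible_on sc T J' W"
  unfolding admissible_on_def
proof (intro allI impI ballI)
  fix f s0 t0
  assume f: "continuous_map (top_of_set J') (sun_star_topology sc T) f \<and> f ` J' \<subseteq> W"
    and st0: "s0 \<in> J'" "t0 \<in> J'" "s0 \<le> t0"
  let ?Q = "\<lambda>s t. \<exists>y. \<forall>x\<in>sun_dual sc T.
    integral {s..t} (\<lambda>\<tau>. f \<tau> (sun_semigroup T (t - \<tau>) x)) = blinfun_apply x y"
  obtain a b where ab: "a \<in> J" "b \<in> J" "a < b"
    using J by (auto simp: nondegenerate_interval_def)
  have sub: "{s..t} \<subseteq> I" if "nondegenerate_interval I" "s \<in> I" "t \<in> I" for I and s t :: real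
    using that mem_is_interval_1_I[of I s t] by (auto simp: nondegenerate_interval_def)
  have integral_eq: "integral {s..t} (\<lambda>\<tau>. sun_star_semigroup sc T (t - \<tau>) (g \<tau>) x)
      = integral {s..t} (\<lambda>\<tau>. g \<tau> (sun_semigroup T (t - \<tau>) x))"
    if "x \<in> sun_dual sc T" for g s t x
    using that by (simp add: sun_star_semigroup_def)
  have short: "?Q s t" if st: "s \<in> J'" "t \<in> J'" "s \<le> t" "t - s \<le> b - a" for s t
  proof -
    define p where "p \<sigma> = max s (min t (\<sigma> + (s - a)))" for \<sigma>
    define c where "c = a + (t - s)"
    have c: "a \<le> c" "c \<in> J"
      using st sub[OF J ab(1,2)] by (auto simp: c_def)
    have p: "p ` J \<subseteq> J'"
      using sub[OF J' st(1,2)] st(3) by (auto simp: p_def)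
    have cont: "continuous_map (top_of_set J) (sun_star_topology sc T) (f \<circ> p)"
      using f p unfolding p_def
      by (intro continuous_map_compose[of _ "top_of_set J'"])
        (auto simp: continuous_map_in_subtopology intro!: continuous_intros)
    moreover have "(f \<circ> p) ` J \<subseteq> W"
      using f p by auto
    ultimately have "weak_star_integral (sun_dual sc T) a c
        (\<lambda>\<tau>. sun_star_semigroup sc T (c - \<tau>) ((f \<circ> p) \<tau>)) \<in> range (sun_embed sc T)"
      using adm ab(1) c unfolding admissible_on_def by blast
    then obtain y where y: "weak_star_integral (sun_dual sc T) a c
        (\<lambda>\<tau>. sun_star_semigroup sc T (c - \<tau>) ((f \<circ> p) \<tau>)) = sun_embed sc T y"
      by blast
    have "integral {s..t} (\<lambda>\<tau>. f \<tau> (sun_semigroup T (t - \<tau>) x)) = blinfun_apply x y"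
      if x: "x \<in> sun_dual sc T" for x
    proof -
      have "blinfun_apply x y = integral {a..c} (\<lambda>\<tau>. f (p \<tau>) (sun_semigroup T (c - \<tau>) x))"
        using fun_cong[OF y, of x] x by (simp add: weak_star_integral_def sun_embed_def integral_eq)
      also have "\<dots> = integral {a..c} ((\<lambda>\<tau>. f \<tau> (sun_semigroup T (t - \<tau>) x)) \<circ> (+) (s - a))"
      proof (rule integral_cong)
        fix \<tau> assume \<tau>: "\<tau> \<in> {a..c}"
        have p\<tau>: "p \<tau> = s - a + \<tau>"
          using \<tau> by (auto simp: p_def c_def)
        have "c - \<tau> = t - (s - a + \<tau>)"
          by (simp add: c_def)
        with p\<tau> show "f (p \<tau>) (sun_semigroup T (c - \<tau>) x)
            = ((\<lambda>\<tau>. f \<tau> (sun_semigroup T (t - \<tau>) x)) \<circ> (+) (s - a)) \<tau>"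
          by (simp only: o_apply)
      qed
      also have "\<dots> = integral {s..t} (\<lambda>\<tau>. f \<tau> (sun_semigroup T (t - \<tau>) x))"
        by (simp add: integral_shift_Icc_real c_def)
      finally show ?thesis ..
    qed
    then show ?thesis
      by blast
  qed
  have "?Q s t" if "s \<in> J'" "t \<in> J'" "s \<le> t" "t - s \<le> real (Suc n) * (b - a)" for n s t
    using that
  proof (induction n arbitrary: s t)
    case 0
    then show ?case
      using short by simp
  next
    case (Suc n)
    define r where "r = max s (t - (b - a))"
    have "t - (b - a) - s \<le> real (Suc n) * (b - a)"
      using Suc.prems by (simp add: algebra_simps)
    moreover have "0 \<le> real (Suc n) * (b - a)"
      using ab by (intro mult_nonneg_nonneg) auto
    ultimately have "r - s \<le> real (Suc n) * (b - a)"
      by (simp add: r_def max_def)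
    with Suc.prems ab sub[OF J' Suc.prems(1,2)]
    have r: "s \<le> r" "r \<le> t" "t - r \<le> b - a" "r - s \<le> real (Suc n) * (b - a)" "r \<in> J'"
      by (auto simp: r_def)
    obtain y where y: "\<And>x. x \<in> sun_dual sc T \<Longrightarrow>
        integral {s..r} (\<lambda>\<tau>. f \<tau> (sun_semigroup T (r - \<tau>) x)) = blinfun_apply x y"
      using Suc.IH[of s r] Suc.prems r by blast
    obtain z where z: "\<And>x. x \<in> sun_dual sc T \<Longrightarrow>
        integral {r..t} (\<lambda>\<tau>. f \<tau> (sun_semigroup T (t - \<tau>) x)) = blinfun_apply x z"
      using short[of r t] Suc.prems r by blast
    have "integral {s..t} (\<lambda>\<tau>. f \<tau> (sun_semigroup T (t - \<tau>) x)) = blinfun_apply x (T (t - r) y + z)"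
      if x: "x \<in> sun_dual sc T" for x
    proof -
      let ?F = "\<lambda>\<tau>. f \<tau> (sun_semigroup T (t - \<tau>) x)"
      have "continuous_on {s..t} ?F"
        using f sub[OF J' Suc.prems(1,2)] x by (intro continuous_on_integrand) auto
      then have "integral {s..t} ?F = integral {s..r} ?F + integral {r..t} ?F"
        using r by (intro Henstock_Kurzweil_Integration.integral_combine[symmetric] integrable_continuous_real) auto
      also have "integral {s..r} ?F
          = integral {s..r} (\<lambda>\<tau>. f \<tau> (sun_semigroup T (r - \<tau>) (sun_semigroup T (t - r) x)))"
      proof (rule integral_cong)
        fix \<tau> assume \<tau>: "\<tau> \<in> {s..r}"
        have "T (t - \<tau>) = T (t - r) o\<^sub>L T (r - \<tau>)"
          using T_add[of "t - r" "r - \<tau>"] \<tau> r by simp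
        then have "sun_semigroup T (t - \<tau>) x = sun_semigroup T (r - \<tau>) (sun_semigroup T (t - r) x)"
          by (intro blinfun_eqI) (simp add: sun_semigroup_def)
        then show "?F \<tau> = f \<tau> (sun_semigroup T (r - \<tau>) (sun_semigroup T (t - r) x))"
          by simp
      qed
      also have "\<dots> = blinfun_apply (sun_semigroup T (t - r) x) y"
        using x r by (intro y sun_semigroup_mem_sun_dual) auto
      also have "\<dots> = blinfun_apply x (T (t - r) y)"
        by (simp add: sun_semigroup_def)
      finally show ?thesis
        using z[OF x] by (simp add: blinfun.add_right)
    qed
    then show ?case
      by blast
  qed
  moreover obtain n where "t0 - s0 \<le> real (Suc n) * (b - a)"
  proof -
    obtain n where "t0 - s0 < real n * (b - a)"
      using reals_Archimedean3[of "b - a"] ab by auto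
    then show ?thesis
      using that[of n] ab by (simp add: algebra_simps)
  qed
  ultimately obtain y where y: "\<forall>x\<in>sun_dual sc T.
      integral {s0..t0} (\<lambda>\<tau>. f \<tau> (sun_semigroup T (t0 - \<tau>) x)) = blinfun_apply x y"
    using st0 by blast
  have "weak_star_integral (sun_dual sc T) s0 t0 (\<lambda>\<tau>. sun_star_semigroup sc T (t0 - \<tau>) (f \<tau>)) x
      = sun_embed sc T y x" for x
    using y by (cases "x \<in> sun_dual sc T") (simp_all add: weak_star_integral_def sun_embed_def integral_eq)
  then have "weak_star_integral (sun_dual sc T) s0 t0 (\<lambda>\<tau>. sun_star_semigroup sc T (t0 - \<tau>) (f \<tau>))
      = sun_embed sc T y"
    by (rule ext)
  then show "weak_star_integral (sun_dual sc T) s0 t0 (\<lambda>\<tau>. sun_star_semigroup sc T (t0 - \<tau>) (f \<tau>))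
      \<in> range (sun_embed sc T)"
    by blast
qed

theorem admissible_range_iff:
  "admissible_range sc T W \<longleftrightarrow>
     closedin (sun_star_topology sc T) W \<and> module.subspace fun_scale W \<and>
     (\<forall>J. nondegenerate_interval J \<longrightarrow> admissible_on sc T J W)"
proof -
  have "nondegenerate_interval UNIV"
    by (auto simp: nondegenerate_interval_def intro: exI[of _ 0] exI[of _ 1])
  then show ?thesis
    unfolding admissible_range_def using admissible_on_change_interval by blast
qed

end

end

theory Submission
  imports Defs
begin

text \<open>
  Let \<open>A\<close> be the generator of \<open>T\<close>, let \<open>R = (\<mu> - A)\<^sup>-\<^sup>1\<close>, and let \<open>\<phi>\<close> be a functional on the sun dual.
  For \<open>f\<close> in the sun dual, \<open>f \<circ> R\<close> is the resolvent of the generator of the sun semigroup applied to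
  \<open>f\<close>, so the resolvent of its adjoint is \<open>\<phi> \<mapsto> (f \<mapsto> \<phi> (f \<circ> R))\<close>, and \<open>\<phi>\<close> belongs to the cross space
  iff \<open>\<phi> (f \<circ> R) = f y\<close> for some vector \<open>y\<close> and all \<open>f\<close> (\<open>mem_sun_cross_iff\<close>).
  Both halves of the theorem come from one differential equation (\<open>sun_star_resolvent_orbit\<close>):
  the function \<open>h s = \<phi> (f \<circ> R \<circ> T s)\<close> satisfies \<open>h' s = \<mu> * h s - \<phi> (f \<circ> T s)\<close>.

  If \<open>\<phi>\<close> is in the cross space, then \<open>h s = f (T s y)\<close>. Integrating the equation writes the integral of
  \<open>\<phi> (f \<circ> T s)\<close> as the value of \<open>f\<close> at a vector independent of \<open>f\<close>; this is admissibility for constant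
  functions (\<open>integral_constant_sun_cross\<close>). A continuous function is locally almost constant, so its
  integrals can be approximated by embedded vectors, with an error proportional to the length of the
  interval. Since the range of the embedding of \<open>X\<close> is closed, the integrals themselves are
  embedded vectors (\<open>admissible_on_sun_cross\<close>). The range is closed because the sun dual norms
  \<open>X\<close> up to a constant (\<open>sun_dual_norming\<close>): the Hahn-Banach theorem provides norming functionals,
  and averaging them over a short piece of the orbits moves them into the sun dual.

  Conversely, let \<open>\<phi>\<close> lie in an admissible range. Applied to the functions \<open>\<tau> \<mapsto> \<phi>\<close> and \<open>\<tau> \<mapsto> \<tau> \<phi>\<close> on
  \<open>[0, 1]\<close>, admissibility gives vectors \<open>c\<close> and \<open>d\<close> with \<open>\<integral> \<phi> (f \<circ> T s) ds = f c\<close> and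
  \<open>\<integral> (1 - s) \<phi> (f \<circ> T s) ds = f d\<close> for all \<open>f\<close>. Integrating the derivative of \<open>(1 - s) * h s\<close>
  over \<open>[0, 1]\<close> and using both identities, also with \<open>f \<circ> R\<close> in place of \<open>f\<close>, yields
  \<open>\<phi> (f \<circ> R) = f (R c + d - \<mu> (R d))\<close> (\<open>admissible_range_subset_sun_cross\<close>).
\<close>

section \<open>Reversing time in an integral\<close>

lemma integral_reverse_time:
  fixes F :: "real \<Rightarrow> 'a::banach"
  shows "integral {a..b} (\<lambda>\<tau>. F (t - \<tau>)) = integral {t - b..t - a} F"
proof -
  have reverse: "((\<lambda>\<tau>. G (t - \<tau>)) has_integral I) {c..d}"
    if "(G has_integral I) {t - d..t - c}" for G :: "real \<Rightarrow> 'a" and I c d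
  proof -
    have "(\<lambda>x. t - x) ` {t - d..t - c} = {c..d}"
      by (auto simp: image_iff intro: bexI[of _ "t - x" for x])
    then show ?thesis
      using has_integral_affinity[of G I "t - d" "t - c" "-1" t] that by simp
  qed
  show ?thesis
  proof (cases "F integrable_on {t - b..t - a}")
    case True
    then show ?thesis
      by (intro integral_unique reverse integrable_integral)
  next
    case False
    then have "\<not> (\<lambda>\<tau>. F (t - \<tau>)) integrable_on {a..b}"
      using reverse[of "\<lambda>\<tau>. F (t - \<tau>)" _ "t - a" "t - b"] by (auto simp: integrable_on_def)
    with False show ?thesis
      by (simp add: not_integrable_integral)
  qed
qed

section \<open>Hahn-Banach by minimal sublinear functions\<close>

text \<open>
  The inequality for multiples, applied to \<open>r > 0\<close> and its inverse, forces equality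
  (\<open>sublinear_scaleR\<close>); the inequality is what an infimum of such functions inherits directly.
\<close>

definition sublinear :: "('a::real_vector \<Rightarrow> real) \<Rightarrow> bool" where
  "sublinear q \<longleftrightarrow> (\<forall>x y. q (x + y) \<le> q x + q y) \<and> (\<forall>r\<ge>0. \<forall>x. q (r *\<^sub>R x) \<le> r * q x)"

lemma
  assumes "sublinear q"
  shows sublinear_add: "q (x + y) \<le> q x + q y"
    and sublinear_scaleR: "0 \<le> r \<Longrightarrow> q (r *\<^sub>R x) = r * q x"
    and sublinear_zero: "q 0 = 0"
    and sublinear_minus: "- q (- x) \<le> q x"
proof -
  show add: "q (x + y) \<le> q x + q y" for x y
    using assms by (simp add: sublinear_def)
  have le: "q (r *\<^sub>R x) \<le> r * q x" if "0 \<le> r" for r x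
    using assms that by (simp add: sublinear_def)
  show zero: "q 0 = 0"
    using le[of 0 0] add[of 0 0] by simp
  show "- q (- x) \<le> q x"
    using add[of x "- x"] zero by simp
  show "q (r *\<^sub>R x) = r * q x" if "0 \<le> r"
  proof (cases "r = 0")
    case True
    then show ?thesis
      by (simp add: zero)
  next
    case False
    with that have r: "0 < r"
      by simp
    have "q x \<le> inverse r * q (r *\<^sub>R x)"
      using le[of "inverse r" "r *\<^sub>R x"] r by simp
    with r have "r * q x \<le> q (r *\<^sub>R x)"
      by (simp add: field_simps)
    with le[of r x] r show ?thesis
      by simp
  qed
qed

text \<open>
  The function \<open>x \<mapsto> (INF t\<ge>0. q (x + t a) - t * q a)\<close> is again sublinear: adding the bounds for \<open>s\<close>
  and \<open>t\<close> gives one for \<open>s + t\<close>. The values \<open>t = 0\<close> and \<open>t = 1\<close> give the two comparisons with \<open>q\<close>.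
  The lemma serves twice: it makes a minimal sublinear function additive, and it produces a
  sublinear function below the norm all of whose linear minorants attain the norm at \<open>a\<close>.
\<close>

lemma sublinear_lower:
  fixes q :: "'a::real_vector \<Rightarrow> real"
  assumes q: "sublinear q"
  shows "\<exists>p. sublinear p \<and> p \<le> q \<and> (\<forall>x. p x \<le> q (x + a) - q a)"
proof -
  define p where "p x = (INF t\<in>{0..}. q (x + t *\<^sub>R a) - t * q a)" for x
  have bdd: "bdd_below ((\<lambda>t. q (x + t *\<^sub>R a) - t * q a) ` {0..})" for x
  proof (rule bdd_belowI2[of _ "- q (- x)"])
    fix t :: real assume "t \<in> {0..}"
    then show "- q (- x) \<le> q (x + t *\<^sub>R a) - t * q a"
      using sublinear_add[OF q, of "x + t *\<^sub>R a" "- x"] sublinear_scaleR[OF q, of t a] by simp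
  qed
  have le: "p x \<le> q (x + t *\<^sub>R a) - t * q a" if "0 \<le> t" for x t
    unfolding p_def using that by (intro cINF_lower bdd) simp
  have ge: "b \<le> p x" if "\<And>t. 0 \<le> t \<Longrightarrow> b \<le> q (x + t *\<^sub>R a) - t * q a" for b x
    unfolding p_def using that by (intro cINF_greatest) auto
  have "p (x + y) \<le> p x + p y" for x y
  proof -
    have "p (x + y) - (q (x + s *\<^sub>R a) - s * q a) \<le> q (y + t *\<^sub>R a) - t * q a"
      if "0 \<le> s" "0 \<le> t" for s t
      using le[of "s + t" "x + y"] sublinear_add[OF q, of "x + s *\<^sub>R a" "y + t *\<^sub>R a"] that
      by (simp add: algebra_simps)
    then have "p (x + y) - p y \<le> q (x + s *\<^sub>R a) - s * q a" if "0 \<le> s" for s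
      using ge[of "p (x + y) - (q (x + s *\<^sub>R a) - s * q a)" y] that by force
    then show ?thesis
      using ge[of "p (x + y) - p y" x] by force
  qed
  moreover have "p (r *\<^sub>R x) \<le> r * p x" if "0 \<le> r" for r x
  proof (cases "r = 0")
    case True
    then show ?thesis
      using le[of 0 0] sublinear_zero[OF q] by simp
  next
    case False
    with that have r: "0 < r"
      by simp
    have "p (r *\<^sub>R x) / r \<le> q (x + t *\<^sub>R a) - t * q a" if "0 \<le> t" for t
    proof -
      have "p (r *\<^sub>R x) \<le> q (r *\<^sub>R (x + t *\<^sub>R a)) - r * t * q a"
        using le[of "r * t" "r *\<^sub>R x"] r that by (simp add: algebra_simps)
      also have "\<dots> = r * (q (x + t *\<^sub>R a) - t * q a)"
        using r sublinear_scaleR[OF q, of r "x + t *\<^sub>R a"] by (simp add: algebra_simps)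
      finally show ?thesis
        using r by (simp add: field_simps)
    qed
    from ge[OF this] show ?thesis
      using r by (simp add: field_simps)
  qed
  moreover have "p \<le> q"
    using le[of 0] by (auto simp: le_fun_def)
  moreover have "p x \<le> q (x + a) - q a" for x
    using le[of 1 x] by simp
  ultimately show ?thesis
    unfolding sublinear_def by blast
qed

text \<open>
  By Zorn's lemma: the pointwise infimum of a nonempty chain below \<open>p\<close> is finite, because every
  member is at least \<open>- p (- x)\<close> at \<open>x\<close>. It is subadditive, because any two members of the chain
  are bounded below by the smaller one, which is subadditive.
\<close>

lemma exists_minimal_sublinear:
  fixes p :: "'a::real_vector \<Rightarrow> real"
  assumes p: "sublinear p"
  shows "\<exists>q. sublinear q \<and> q \<le> p \<and> (\<forall>r. sublinear r \<longrightarrow> r \<le> q \<longrightarrow> r = q)"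
proof -
  define A where "A = {q. sublinear q \<and> q \<le> p}"
  have "\<exists>m\<in>A. \<forall>q\<in>A. q \<le> m \<longrightarrow> q = m"
  proof (rule predicate_Zorn[of A "\<lambda>r q. q \<le> r"])
    show "partial_order_on A (relation_of (\<lambda>r q. q \<le> r) A)"
      by (rule partial_order_on_relation_ofI) auto
  next
    fix C assume C: "C \<in> Chains (relation_of (\<lambda>r q. q \<le> r) A)"
    have CA: "q \<in> A" if "q \<in> C" for q
      using C that unfolding Chains_def relation_of_def by blast
    have chain: "q \<le> r \<or> r \<le> q" if "q \<in> C" "r \<in> C" for q r
      using C that unfolding Chains_def relation_of_def by blast
    show "\<exists>u\<in>A. \<forall>q\<in>C. u \<le> q"
    proof (cases "C = {}")
      case True
      with p show ?thesis
        by (auto simp: A_def)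
    next
      case False
      define u where "u x = (INF q\<in>C. q x)" for x
      have bdd: "bdd_below ((\<lambda>q. q x) ` C)" for x
      proof (rule bdd_belowI2[of _ "- p (- x)"])
        fix q assume "q \<in> C"
        then have q: "sublinear q" "q (- x) \<le> p (- x)"
          using CA by (auto simp: A_def le_fun_def)
        then show "- p (- x) \<le> q x"
          using sublinear_minus[OF q(1), of x] by simp
      qed
      have le: "u x \<le> q x" if "q \<in> C" for q x
        unfolding u_def using that by (intro cINF_lower bdd)
      have ge: "b \<le> u x" if "\<And>q. q \<in> C \<Longrightarrow> b \<le> q x" for b x
        unfolding u_def using that False by (intro cINF_greatest)
      have "u (x + y) \<le> u x + u y" for x y
      proof -
        have "u (x + y) - q x \<le> r y" if qr: "q \<in> C" "r \<in> C" for q r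
        proof -
          obtain s where s: "s \<in> C" "s \<le> q" "s \<le> r"
            using chain[OF qr] qr by auto
          have "u (x + y) \<le> s x + s y"
            using le[OF s(1), of "x + y"] sublinear_add[of s x y] CA[OF s(1)] by (simp add: A_def)
          also have "\<dots> \<le> q x + r y"
            using s by (intro add_mono) (auto simp: le_fun_def)
          finally show ?thesis
            by simp
        qed
        then have "u (x + y) - u y \<le> q x" if "q \<in> C" for q
          using ge[of "u (x + y) - q x" y] that by force
        then show ?thesis
          using ge[of "u (x + y) - u y" x] by force
      qed
      moreover have "u (r *\<^sub>R x) \<le> r * u x" if "0 \<le> r" for r x
      proof -
        have *: "u (r *\<^sub>R x) \<le> r * q x" if "q \<in> C" for q
          using le[OF that, of "r *\<^sub>R x"] sublinear_scaleR[of q r x] CA[OF that] \<open>0 \<le> r\<close>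
          by (simp add: A_def)
        show ?thesis
        proof (cases "r = 0")
          case True
          then show ?thesis
            using * False by auto
        next
          case False
          then have "u (r *\<^sub>R x) / r \<le> u x"
            using * \<open>0 \<le> r\<close> by (intro ge) (simp add: field_simps)
          then show ?thesis
            using False \<open>0 \<le> r\<close> by (simp add: field_simps)
        qed
      qed
      moreover have "u \<le> p"
      proof -
        obtain q where "q \<in> C"
          using False by blast
        then have "u \<le> q" "q \<le> p"
          using le CA by (auto simp: A_def le_fun_def)
        then show ?thesis
          by (rule order_trans)
      qed
      ultimately have "u \<in> A"
        by (simp add: A_def sublinear_def)
      with le show ?thesis
        by (auto simp: le_fun_def)
    qed
  qed
  then obtain m where m: "m \<in> A" and min: "\<And>q. q \<in> A \<Longrightarrow> q \<le> m \<Longrightarrow> q = m"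
    by blast
  have "r = m" if "sublinear r" "r \<le> m" for r
    using that m min[of r] order_trans[of r m p] by (simp add: A_def)
  with m show ?thesis
    unfolding A_def by blast
qed

text \<open>
  A minimal sublinear function \<open>q\<close> coincides with its lowering at \<open>y\<close>, which says
  \<open>q x + q y \<le> q (x + y)\<close>. So \<open>q\<close> is additive, and a sublinear additive function is linear.
\<close>

lemma hahn_banach_sublinear:
  fixes p :: "'a::real_vector \<Rightarrow> real"
  assumes p: "sublinear p"
  shows "\<exists>f. linear f \<and> f \<le> p"
proof -
  obtain q where q: "sublinear q" "q \<le> p" and min: "\<And>r. sublinear r \<Longrightarrow> r \<le> q \<Longrightarrow> r = q"
    using exists_minimal_sublinear[OF p] by blast
  have add: "q (x + y) = q x + q y" for x y
  proof -
    obtain r where "sublinear r" "r \<le> q" "r x \<le> q (x + y) - q y"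
      using sublinear_lower[OF q(1), of y] by blast
    then have "q x \<le> q (x + y) - q y"
      using min by blast
    with sublinear_add[OF q(1), of x y] show ?thesis
      by simp
  qed
  have minus: "q (- x) = - q x" for x
    using add[of x "- x"] sublinear_zero[OF q(1)] by simp
  have "q (r *\<^sub>R x) = r *\<^sub>R q x" for r x
  proof (cases "0 \<le> r")
    case False
    then have "q ((- r) *\<^sub>R x) = - r * q x"
      by (intro sublinear_scaleR[OF q(1)]) simp
    then show ?thesis
      using minus[of "r *\<^sub>R x"] by simp
  qed (simp add: sublinear_scaleR[OF q(1)])
  with add have "linear q"
    by (rule linearI)
  with q(2) show ?thesis
    by blast
qed

lemma real_norming_functional:
  fixes a :: "'a::real_normed_vector"
  shows "\<exists>f. linear f \<and> (\<forall>x. \<bar>f x\<bar> \<le> norm x) \<and> f a = norm a"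
proof -
  have "sublinear (norm :: 'a \<Rightarrow> real)"
    by (simp add: sublinear_def norm_triangle_ineq)
  from sublinear_lower[OF this, of a] obtain p where p: "sublinear p" "p \<le> norm"
    "\<forall>x. p x \<le> norm (x + a) - norm a"
    by blast
  obtain f where f: "linear f" "f \<le> p"
    using hahn_banach_sublinear[OF p(1)] by blast
  interpret linear f
    by fact
  have le: "f x \<le> norm x" for x
    using f(2) p(2) by (auto simp: le_fun_def intro: order_trans)
  \<comment> \<open>\<open>p\<close> is the norm lowered at \<open>a\<close>; its bound at \<open>- a\<close> forces every linear minorant to attain \<open>norm a\<close>.\<close>
  have "f (- a) \<le> norm (- a + a) - norm a"
    using f(2) p(3) unfolding le_fun_def by (blast intro: order_trans)
  then have "norm a \<le> f a"
    by (simp add: neg)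
  moreover have "\<bar>f x\<bar> \<le> norm x" for x
    using le[of x] le[of "- x"] by (simp add: neg)
  ultimately show ?thesis
    using f(1) le[of a] by (intro exI[of _ f]) auto
qed

context banach_over
begin

lemma scale_scaleR: "sc c (r *\<^sub>R x) = r *\<^sub>R sc c x"
  by (metis scale_of_real scale_left_commute)

lemma bounded_linear_scale: "bounded_linear (sc c)"
  by (rule bounded_linear_intro[of _ "norm c"])
    (auto simp: scale_right_distrib scale_scaleR norm_scale mult.commute)

text \<open>
  Over the reals a real norming functional \<open>f\<close> will do. Otherwise \<open>x \<mapsto> f x - f (\<i> x) \<i>\<close> is
  linear over the complex scalars and has \<open>f\<close> as its real part, so it is at least as large
  as \<open>f\<close>; the triangle inequality bounds its norm by \<open>2\<close>.
\<close>

lemma norming_functional: "\<exists>f\<in>dual sc. norm f \<le> 2 \<and> norm a \<le> norm (blinfun_apply f a)"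
proof -
  obtain f where f: "linear f" "\<And>x. \<bar>f x\<bar> \<le> norm x" "f a = norm a"
    using real_norming_functional[of a] by blast
  interpret linear f
    by fact
  consider (real) "\<forall>z::'k. \<exists>r. z = r *\<^sub>R 1"
    | (complex) i :: 'k where "i * i = - 1" "\<forall>z. \<exists>r s. z = r *\<^sub>R 1 + s *\<^sub>R i"
        "\<forall>r s. norm (r *\<^sub>R 1 + s *\<^sub>R i) = sqrt (r\<^sup>2 + s\<^sup>2)"
    using real_or_complex[where 'a='k] by blast
  then show ?thesis
  proof cases
    case real
    define F where "F x = f x *\<^sub>R (1::'k)" for x
    have "bounded_linear F"
      unfolding F_def
      by (rule bounded_linear_intro[of _ 1]) (auto simp: add scale algebra_simps f(2))
    note F = bounded_linear_Blinfun_apply[OF this]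
    have "Blinfun F \<in> dual sc"
      unfolding dual_def
    proof (intro CollectI allI)
      fix c :: 'k and x :: 'a
      obtain r where "c = of_real r"
        unfolding of_real_def using real by blast
      then show "Blinfun F (sc c x) = c * Blinfun F x"
        by (simp add: F scale_of_real) (simp add: F_def scale scaleR_conv_of_real)
    qed
    moreover have "norm (Blinfun F) \<le> 2"
      by (rule norm_blinfun_bound) (auto simp: F F_def intro: order_trans[OF f(2)])
    ultimately show ?thesis
      using f(3) by (intro bexI[of _ "Blinfun F"]) (auto simp: F F_def)
  next
    case (complex i)
    have norm_i: "norm i = 1"
      using complex(3)[rule_format, of 0 1] by simp
    define F where "F x = f x *\<^sub>R 1 - f (sc i x) *\<^sub>R i" for x
    have bound: "norm (F x) \<le> 2 * norm x" for x
    proof -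
      have "norm (F x) \<le> \<bar>f x\<bar> + \<bar>f (sc i x)\<bar>"
        unfolding F_def using norm_triangle_ineq4[of "f x *\<^sub>R 1" "f (sc i x) *\<^sub>R i"] norm_i by simp
      then show ?thesis
        using f(2)[of x] f(2)[of "sc i x"] norm_i by (simp add: norm_scale)
    qed
    have bl: "bounded_linear F"
    proof (rule bounded_linear_intro[of _ 2])
      show "F (x + y) = F x + F y" for x y
        by (simp add: F_def add scale_right_distrib scaleR_left_distrib)
      show "F (r *\<^sub>R x) = r *\<^sub>R F x" for r x
        by (simp add: F_def scale scale_scaleR scaleR_right_diff_distrib)
      show "norm (F x) \<le> norm x * 2" for x
        using bound[of x] by simp
    qed
    note F = bounded_linear_Blinfun_apply[OF bl]
    interpret F: bounded_linear F
      by fact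
    have F_i: "F (sc i x) = i * F x" for x
    proof -
      have "sc i (sc i x) = - x"
        using scale_of_real[of "-1" x] by (simp add: complex(1))
      then show ?thesis
        by (simp add: F_def neg right_diff_distrib complex(1))
    qed
    have "Blinfun F \<in> dual sc"
      unfolding dual_def
    proof (intro CollectI allI)
      fix c :: 'k and x :: 'a
      obtain r s where c: "c = r *\<^sub>R 1 + s *\<^sub>R i"
        using complex(2) by blast
      have "sc c x = r *\<^sub>R x + s *\<^sub>R sc i x"
        using scale_of_real[of r x] scale_of_real[of s "sc i x"]
        by (simp add: c scale_left_distrib scaleR_conv_of_real)
      then show "Blinfun F (sc c x) = c * Blinfun F x"
        by (simp add: F F.add F.scaleR F_i c distrib_right)
    qed
    moreover have "norm (Blinfun F) \<le> 2"
      by (rule norm_blinfun_bound) (auto simp: F bound)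
    moreover have "norm a \<le> norm (Blinfun F a)"
    proof -
      have "norm (F a) = sqrt ((f a)\<^sup>2 + (- f (sc i a))\<^sup>2)"
        using complex(3)[rule_format, of "f a" "- f (sc i a)"] by (simp add: F_def)
      then show ?thesis
        by (simp add: F f(3) real_le_rsqrt)
    qed
    ultimately show ?thesis
      by (intro bexI[of _ "Blinfun F"]) auto
  qed
qed

end

section \<open>Orbits and the norming property of the sun dual\<close>

context c0_semigroup
begin

lemma diff_mem_sun_dual: "f \<in> sun_dual sc T \<Longrightarrow> g \<in> sun_dual sc T \<Longrightarrow> f - g \<in> sun_dual sc T"
  using add_mem_sun_dual[of f "- 1 *\<^sub>R g"] scaleR_mem_sun_dual[of g "- 1"] by simp

lemma sun_dual_in_dual: "f \<in> sun_dual sc T \<Longrightarrow> f \<in> dual sc"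
  by (simp add: sun_dual_def)

lemma T_commute: "0 \<le> s \<Longrightarrow> 0 \<le> t \<Longrightarrow> T s (T t x) = T t (T s x)"
  using T_add[of s t] T_add[of t s] by (metis add.commute blinfun_apply_blinfun_compose)

lemma T_add_apply: "0 \<le> s \<Longrightarrow> 0 \<le> t \<Longrightarrow> T (s + t) x = T s (T t x)"
  by (simp add: T_add)

lemma continuous_on_orbit: "continuous_on {0..} (\<lambda>t. T t x)"
  unfolding continuous_on_iff
proof (intro ballI allI impI)
  fix t0 e :: real assume t0: "t0 \<in> {0..}" and e: "0 < e"
  obtain B where B: "B > 0" "\<And>t. t \<in> {0..t0 + 1} \<Longrightarrow> norm (T t) \<le> B"
    using bounded_on_compact by blast
  have "\<forall>\<^sub>F h in at_right 0. dist (T h x) x < e / B"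
    using T_strongly_continuous[of x] e B by (intro tendstoD) auto
  then obtain d where d: "d > 0" "\<And>h. 0 < h \<Longrightarrow> h < d \<Longrightarrow> norm (T h x - x) < e / B"
    unfolding eventually_at_right_field by (auto simp: dist_norm)
  have *: "norm (T b x - T a x) < e" if "0 \<le> a" "a < b" "b - a < d" "a \<le> t0 + 1" for a b
  proof -
    have "T b x - T a x = T a (T (b - a) x - x)"
      using T_add_apply[of a "b - a" x] that by (simp add: blinfun.diff_right)
    then have "norm (T b x - T a x) \<le> norm (T a) * norm (T (b - a) x - x)"
      by (simp add: norm_blinfun)
    also have "\<dots> \<le> B * norm (T (b - a) x - x)"
      using that B by (intro mult_right_mono) auto
    also have "\<dots> < e"
      using d(2)[of "b - a"] that B by (simp add: field_simps)
    finally show ?thesis .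
  qed
  show "\<exists>d>0. \<forall>t\<in>{0..}. dist t t0 < d \<longrightarrow> dist (T t x) (T t0 x) < e"
  proof (intro exI[of _ "min d 1"] conjI ballI impI)
    fix t :: real assume t: "t \<in> {0..}" "dist t t0 < min d 1"
    consider "t < t0" | "t = t0" | "t0 < t"
      by linarith
    then show "dist (T t x) (T t0 x) < e"
      using *[of t t0] *[of t0 t] t t0 e
      by cases (auto simp: dist_norm norm_minus_commute)
  qed (use d in auto)
qed

lemma integrable_orbit: "0 \<le> a \<Longrightarrow> (\<lambda>s. T s x) integrable_on {a..b}"
  by (intro integrable_continuous_real continuous_on_subset[OF continuous_on_orbit]) auto

lemma norm_integral_orbit_le:
  assumes "0 \<le> a" "a \<le> b" and M: "\<And>s. s \<in> {a..b} \<Longrightarrow> norm (T s) \<le> M"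
  shows "norm (integral {a..b} (\<lambda>s. T s x)) \<le> M * norm x * (b - a)"
proof (rule integral_bound)
  show "continuous_on {a..b} (\<lambda>s. T s x)"
    using assms by (intro continuous_on_subset[OF continuous_on_orbit]) auto
  show "norm (T s x) \<le> M * norm x" if "s \<in> {a..b}" for s
    using norm_blinfun[of "T s" x] mult_right_mono[OF M[OF that], of "norm x"] by simp
qed fact

lemma bounded_linear_integral_orbit:
  assumes h: "0 \<le> h"
  shows "bounded_linear (\<lambda>x. integral {0..h} (\<lambda>s. T s x))"
proof -
  obtain M where "M > 0" "\<And>s. s \<in> {0..h} \<Longrightarrow> norm (T s) \<le> M"
    using bounded_on_compact by blast
  then have "norm (integral {0..h} (\<lambda>s. T s x)) \<le> norm x * (M * h)" for x
    using norm_integral_orbit_le[of 0 h M x] h by (simp add: mult_ac)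
  then show ?thesis
    by (intro bounded_linear_intro[of _ "M * h"])
      (simp_all add: blinfun.add_right blinfun.scaleR_right integral_add integrable_orbit)
qed

text \<open>
  With \<open>S x = \<integral>\<^sub>0\<^sup>h T s x ds\<close>, the difference \<open>S (T t x) - S x\<close> is the integral over \<open>[h, h + t]\<close> minus
  that over \<open>[0, t]\<close>, hence of size \<open>O(t)\<close> uniformly in the unit ball.
\<close>

lemma integral_orbit_mem_sun_dual:
  assumes f: "f \<in> dual sc" and h: "0 \<le> h"
  shows "f o\<^sub>L Blinfun (\<lambda>x. integral {0..h} (\<lambda>s. T s x)) \<in> sun_dual sc T"
proof -
  let ?I = "\<lambda>a b x. integral {a..b} (\<lambda>s. T s x)"
  define S where "S = Blinfun (?I 0 h)"
  have S: "S x = ?I 0 h x" for x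
    unfolding S_def by (rule bounded_linear_Blinfun_apply[OF bounded_linear_integral_orbit[OF h], THEN fun_cong])
  have "S (sc c x) = sc c (S x)" for c x
  proof -
    have "?I 0 h (sc c x) = integral {0..h} (sc c \<circ> (\<lambda>s. T s x))"
      by (rule integral_cong) (simp add: T_scale)
    also have "\<dots> = sc c (?I 0 h x)"
      by (intro integral_linear integrable_orbit bounded_linear_scale) simp
    finally show ?thesis
      by (simp add: S)
  qed
  then have "f o\<^sub>L S \<in> dual sc"
    using f by (simp add: dual_def)
  moreover obtain M where M: "M > 0" "\<And>s. s \<in> {0..h + 1} \<Longrightarrow> norm (T s) \<le> M"
    using bounded_on_compact by blast
  have le: "norm (((f o\<^sub>L S) o\<^sub>L T t) - (f o\<^sub>L S)) \<le> norm f * (2 * M) * t" if t: "0 < t" "t < 1" for t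
  proof (rule norm_blinfun_bound)
    fix x
    have "?I 0 h (T t x) = integral {0..h} ((\<lambda>s. T s x) \<circ> (+) t)"
      by (rule integral_cong) (use t in \<open>simp add: T_add_apply T_commute\<close>)
    also have "\<dots> = ?I t (t + h) x"
      by (simp add: integral_shift_Icc_real add.commute)
    finally have "S (T t x) - S x = ?I t (t + h) x - ?I 0 h x"
      by (simp add: S)
    also have "\<dots> = ?I h (t + h) x - ?I 0 t x"
      using Henstock_Kurzweil_Integration.integral_combine[of 0 t "t + h" "\<lambda>s. T s x"]
        Henstock_Kurzweil_Integration.integral_combine[of 0 h "t + h" "\<lambda>s. T s x"] t h
      by (simp add: integrable_orbit algebra_simps)
    finally have "norm (S (T t x) - S x) \<le> norm (?I h (t + h) x) + norm (?I 0 t x)"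
      using norm_triangle_ineq4 by metis
    also have "\<dots> \<le> M * norm x * (t + h - h) + M * norm x * (t - 0)"
      using t h M by (intro add_mono norm_integral_orbit_le) auto
    finally have "norm (f (S (T t x) - S x)) \<le> norm f * (2 * M * norm x * t)"
      by (intro order_trans[OF norm_blinfun] mult_left_mono) (auto simp: algebra_simps)
    then show "norm (blinfun_apply (((f o\<^sub>L S) o\<^sub>L T t) - (f o\<^sub>L S)) x) \<le> norm f * (2 * M) * t * norm x"
      by (simp add: blinfun.diff_left blinfun.diff_right algebra_simps)
  qed (use M t in auto)
  have "((\<lambda>t. norm (((f o\<^sub>L S) o\<^sub>L T t) - (f o\<^sub>L S))) \<longlongrightarrow> 0) (at_right 0)"
  proof (rule tendsto_sandwich[OF _ _ tendsto_const])
    show "((\<lambda>t. norm f * (2 * M) * t) \<longlongrightarrow> 0) (at_right 0)"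
      by (intro tendsto_mult_right_zero tendsto_ident_at)
    show "\<forall>\<^sub>F t in at_right 0. norm (((f o\<^sub>L S) o\<^sub>L T t) - (f o\<^sub>L S)) \<le> norm f * (2 * M) * t"
      unfolding eventually_at_right_field using le by (intro exI[of _ 1]) auto
  qed auto
  ultimately show ?thesis
    by (simp add: sun_dual_def S_def)
qed

text \<open>
  For small \<open>h\<close>, depending on \<open>x\<close>, the average \<open>S x / h\<close> of the orbit of \<open>x\<close> over \<open>[0, h]\<close> has norm at
  least \<open>norm x / 2\<close>. A functional \<open>g\<close> of norm at most \<open>2\<close> that norms \<open>S x\<close> gives \<open>(2 / h) (g \<circ> S)\<close>, whose norm
  is bounded independently of \<open>h\<close>.
\<close>

lemma sun_dual_norming:
  "\<exists>C>0. \<forall>x. \<exists>f\<in>sun_dual sc T. norm f \<le> C \<and> norm x \<le> norm (blinfun_apply f x)"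
proof -
  obtain M where M: "M > 0" "\<And>s. s \<in> {0..1} \<Longrightarrow> norm (T s) \<le> M"
    using bounded_on_compact by blast
  have "\<exists>f\<in>sun_dual sc T. norm f \<le> 4 * M \<and> norm x \<le> norm (blinfun_apply f x)" for x
  proof (cases "x = 0")
    case True
    then show ?thesis
      using zero_mem_sun_dual M by (intro bexI[of _ 0]) auto
  next
    case False
    have "\<forall>\<^sub>F h in at_right 0. dist (T h x) x < norm x / 2"
      using T_strongly_continuous[of x] False by (intro tendstoD) auto
    then obtain d where d: "d > 0" "\<And>h. 0 < h \<Longrightarrow> h < d \<Longrightarrow> norm (T h x - x) < norm x / 2"
      unfolding eventually_at_right_field by (auto simp: dist_norm)
    \<comment> \<open>\<open>h < d\<close> keeps the orbit near \<open>x\<close>, and \<open>h \<le> 1\<close> makes the bound \<open>M\<close> available.\<close>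
    define h where "h = min 1 (d / 2)"
    have h: "0 < h" "h \<le> 1" "h < d"
      using d by (auto simp: h_def)
    define S where "S = Blinfun (\<lambda>x. integral {0..h} (\<lambda>s. T s x))"
    have S: "S y = integral {0..h} (\<lambda>s. T s y)" for y
      unfolding S_def using h
      by (intro bounded_linear_Blinfun_apply[OF bounded_linear_integral_orbit, THEN fun_cong]) simp
    have norm_S: "norm S \<le> M * h"
    proof (rule norm_blinfun_bound)
      fix y
      show "norm (S y) \<le> M * h * norm y"
        using norm_integral_orbit_le[of 0 h M y] h M by (simp add: S mult_ac)
    qed (use M h in simp)
    have "norm (S x - h *\<^sub>R x) \<le> norm x / 2 * (h - 0)"
    proof -
      have "S x - h *\<^sub>R x = integral {0..h} (\<lambda>s. T s x - x)"
        using h Henstock_Kurzweil_Integration.integral_diff[OF integrable_orbit[of 0 x h]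
            integrable_continuous_real[OF continuous_on_const[of "{0..h}" x]]]
        by (simp add: S)
      also have "norm \<dots> \<le> norm x / 2 * (h - 0)"
      proof (rule integral_bound)
        show "continuous_on {0..h} (\<lambda>s. T s x - x)"
          by (intro continuous_intros continuous_on_subset[OF continuous_on_orbit]) auto
        show "norm (T s x - x) \<le> norm x / 2" if "s \<in> {0..h}" for s
          using d(2)[of s] h that by (cases "s = 0") (auto simp: T_0)
      qed (use h in simp)
      finally show ?thesis .
    qed
    moreover have "norm (h *\<^sub>R x) - norm (S x - h *\<^sub>R x) \<le> norm (S x)"
      using norm_triangle_ineq2[of "h *\<^sub>R x" "h *\<^sub>R x - S x"] by (simp add: norm_minus_commute)
    ultimately have ge: "h * norm x \<le> 2 * norm (S x)"
      using h by (simp add: mult.commute[of h])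
    obtain g where g: "g \<in> dual sc" "norm g \<le> 2" "norm (S x) \<le> norm (blinfun_apply g (S x))"
      using norming_functional by blast
    define f where "f = (2 / h) *\<^sub>R (g o\<^sub>L S)"
    have "f \<in> sun_dual sc T"
      unfolding f_def S_def using g h by (intro scaleR_mem_sun_dual integral_orbit_mem_sun_dual) auto
    moreover have "norm f \<le> 4 * M"
    proof -
      have "norm (g o\<^sub>L S) \<le> 2 * (M * h)"
        using g norm_S by (intro order_trans[OF norm_blinfun_compose] mult_mono) auto
      then show ?thesis
        using h by (simp add: f_def field_simps)
    qed
    moreover have "norm x \<le> norm (blinfun_apply f x)"
      using ge g(3) h by (simp add: f_def blinfun.scaleR_left field_simps)
    ultimately show ?thesis
      by blast
  qed
  then show ?thesis
    using M by (intro exI[of _ "4 * M"]) auto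
qed

text \<open>
  The range of the embedding is closed, stated for any function that is approximated by embedded
  vectors uniformly on bounded subsets of the sun dual: by the norming property
  approximating vectors form a Cauchy sequence, and its limit represents the function.
\<close>

lemma sun_embed_closed:
  assumes "\<And>e. 0 < e \<Longrightarrow> \<exists>y. \<forall>f\<in>sun_dual sc T. norm (\<phi> f - blinfun_apply f y) \<le> e * norm f"
  shows "\<exists>y. \<forall>f\<in>sun_dual sc T. \<phi> f = blinfun_apply f y"
proof -
  obtain C where C: "C > 0" "\<And>x. \<exists>f\<in>sun_dual sc T. norm f \<le> C \<and> norm x \<le> norm (blinfun_apply f x)"
    using sun_dual_norming by blast
  have "\<exists>y. \<forall>n. \<forall>f\<in>sun_dual sc T.
      norm (\<phi> f - blinfun_apply f (y n)) \<le> inverse (real (Suc n)) * norm f"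
    by (intro choice allI assms) simp
  then obtain y where y: "\<And>n f. f \<in> sun_dual sc T \<Longrightarrow>
      norm (\<phi> f - blinfun_apply f (y n)) \<le> inverse (real (Suc n)) * norm f"
    by blast
  have diff: "norm (y m - y n) \<le> (inverse (real (Suc m)) + inverse (real (Suc n))) * C" for m n
  proof -
    obtain f where f: "f \<in> sun_dual sc T" "norm f \<le> C" "norm (y m - y n) \<le> norm (f (y m - y n))"
      using C(2) by blast
    have "f (y m - y n) = (\<phi> f - f (y n)) - (\<phi> f - f (y m))"
      by (simp add: blinfun.diff_right)
    also have "norm \<dots> \<le> norm (\<phi> f - f (y n)) + norm (\<phi> f - f (y m))"
      by (rule norm_triangle_ineq4)
    also have "\<dots> \<le> inverse (real (Suc n)) * norm f + inverse (real (Suc m)) * norm f"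
      using f by (intro add_mono y)
    also have "\<dots> = (inverse (real (Suc m)) + inverse (real (Suc n))) * norm f"
      by (simp add: algebra_simps)
    also have "\<dots> \<le> (inverse (real (Suc m)) + inverse (real (Suc n))) * C"
      using f by (intro mult_left_mono) auto
    finally show ?thesis
      using f(3) by simp
  qed
  have "Cauchy y"
  proof (rule metric_CauchyI)
    fix e :: real assume "0 < e"
    then obtain N where N: "inverse (real (Suc N)) < e / (2 * C)"
      using C reals_Archimedean[of "e / (2 * C)"] by auto
    show "\<exists>N. \<forall>m\<ge>N. \<forall>n\<ge>N. dist (y m) (y n) < e"
    proof (intro exI[of _ N] allI impI)
      fix m n assume "N \<le> m" "N \<le> n"
      then have "inverse (real (Suc m)) \<le> inverse (real (Suc N))"
        "inverse (real (Suc n)) \<le> inverse (real (Suc N))"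
        by (auto intro!: le_imp_inverse_le)
      with N have "inverse (real (Suc m)) + inverse (real (Suc n)) < e / (2 * C) + e / (2 * C)"
        by linarith
      then have "(inverse (real (Suc m)) + inverse (real (Suc n))) * C < e"
        using C by (simp add: field_simps)
      with diff[of m n] show "dist (y m) (y n) < e"
        unfolding dist_norm by linarith
    qed
  qed
  then obtain z where z: "y \<longlonglongrightarrow> z"
    using Cauchy_convergent convergent_def by blast
  have "\<phi> f = f z" if f: "f \<in> sun_dual sc T" for f
  proof -
    have "(\<lambda>n. norm (\<phi> f - f (y n))) \<longlonglongrightarrow> 0"
      using y[OF f] by (intro tendsto_sandwich[OF _ _ tendsto_const
            tendsto_mult_left_zero[OF LIMSEQ_inverse_real_of_nat, of "norm f"]]) auto
    moreover have "(\<lambda>n. norm (\<phi> f - f (y n))) \<longlonglongrightarrow> norm (\<phi> f - f z)"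
      by (intro tendsto_intros z)
    ultimately show ?thesis
      using LIMSEQ_unique by fastforce
  qed
  then show ?thesis
    by blast
qed

section \<open>Differentiability of orbits\<close>

abbreviation gen :: "('a \<times> 'a) set" where
  "gen \<equiv> generator UNIV (\<lambda>t. blinfun_apply (T t))"

text \<open>
  The generator is defined by a right derivative at \<open>0\<close>. The semigroup law transports it to a right
  derivative at any \<open>a\<close>, with an error that is uniform in \<open>a\<close> on bounded sets. This uniformity also gives the
  left derivative at \<open>s\<close>: use the right derivative at \<open>t < s\<close> and the continuity of the orbit of \<open>z\<close>.
\<close>

lemma orbit_has_vector_derivative:
  assumes xz: "(x, z) \<in> gen" and s: "0 \<le> s"
  shows "((\<lambda>t. T t x) has_vector_derivative T s z) (at s within {0..})"
  unfolding has_vector_derivative_def has_derivative_within_alt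
proof (intro conjI allI impI)
  show "bounded_linear (\<lambda>h. h *\<^sub>R T s z)"
    by (rule bounded_linear_scaleR_left)
  fix e :: real assume e: "0 < e"
  obtain B where B: "B > 0" "\<And>t. t \<in> {0..s} \<Longrightarrow> norm (T t) \<le> B"
    using bounded_on_compact by blast
  have "((\<lambda>h. (T h x - x) /\<^sub>R h) \<longlongrightarrow> z) (at_right 0)"
    using xz by (simp add: generator_def)
  then have "\<forall>\<^sub>F h in at_right 0. dist ((T h x - x) /\<^sub>R h) z < e / (2 * B)"
    using e B by (intro tendstoD) auto
  then obtain d where d: "d > 0"
    "\<And>h. 0 < h \<Longrightarrow> h < d \<Longrightarrow> norm ((T h x - x) /\<^sub>R h - z) < e / (2 * B)"
    unfolding eventually_at_right_field by (auto simp: dist_norm)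
  have step: "norm (T b x - T a x - (b - a) *\<^sub>R T a z) \<le> e / 2 * (b - a)"
    if "0 \<le> a" "a < b" "b - a < d" "a \<le> s" for a b
  proof -
    define h where "h = b - a"
    have h: "0 < h" "h < d" "b = a + h"
      using that by (auto simp: h_def)
    have "T b x - T a x - (b - a) *\<^sub>R T a z = h *\<^sub>R T a ((T h x - x) /\<^sub>R h - z)"
      using T_add_apply[of a h x] that h
      by (simp add: blinfun.diff_right blinfun.scaleR_right scaleR_diff_right)
    also have "norm \<dots> \<le> h * (norm (T a) * norm ((T h x - x) /\<^sub>R h - z))"
      using h by (simp add: norm_blinfun)
    also have "\<dots> \<le> h * (B * (e / (2 * B)))"
      using h that B less_imp_le[OF d(2)[of h]] by (intro mult_left_mono mult_mono) auto
    also have "\<dots> = e / 2 * (b - a)"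
      using B by (simp add: h_def)
    finally show ?thesis .
  qed
  obtain d' where d': "d' > 0"
    "\<And>t. 0 \<le> t \<Longrightarrow> dist t s < d' \<Longrightarrow> dist (T t z) (T s z) < e / 2"
    using continuous_on_orbit[of z] s e unfolding continuous_on_iff
    by (metis atLeast_iff half_gt_zero)
  show "\<exists>d>0. \<forall>t\<in>{0..}. norm (t - s) < d \<longrightarrow>
      norm (T t x - T s x - (t - s) *\<^sub>R T s z) \<le> e * norm (t - s)"
  proof (intro exI[of _ "min d d'"] conjI ballI impI)
    fix t :: real assume t: "t \<in> {0..}" "norm (t - s) < min d d'"
    consider "t < s" | "t = s" | "s < t"
      by linarith
    then show "norm (T t x - T s x - (t - s) *\<^sub>R T s z) \<le> e * norm (t - s)"
    proof cases
      case 1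
      have "T t x - T s x - (t - s) *\<^sub>R T s z
          = (s - t) *\<^sub>R (T s z - T t z) - (T s x - T t x - (s - t) *\<^sub>R T t z)"
        by (simp add: algebra_simps)
      also have "norm \<dots> \<le> norm ((s - t) *\<^sub>R (T s z - T t z))
          + norm (T s x - T t x - (s - t) *\<^sub>R T t z)"
        by (rule norm_triangle_ineq4)
      also have "\<dots> \<le> (s - t) * norm (T s z - T t z) + e / 2 * (s - t)"
        using step[of t s] t 1 by simp
      also have "\<dots> \<le> (s - t) * (e / 2) + e / 2 * (s - t)"
        using d'(2)[of t] t 1 e
        by (intro add_mono mult_left_mono) (auto simp: dist_norm norm_minus_commute)
      also have "\<dots> = e * norm (t - s)"
        using 1 by (simp add: algebra_simps)
      finally show ?thesis .
    next
      case 3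
      then have "e / 2 * (t - s) \<le> e * (t - s)"
        using e by (intro mult_right_mono) auto
      then show ?thesis
        using step[of s t] t s 3 by simp
    qed simp
  qed (use d d' in auto)
qed

lemma gen_orbit:
  assumes "(x, z) \<in> gen" "0 \<le> t"
  shows "(T t x, T t z) \<in> gen"
proof -
  have "((\<lambda>h. T t ((T h x - x) /\<^sub>R h)) \<longlongrightarrow> T t z) (at_right 0)"
    using assms by (intro tendsto_intros) (simp add: generator_def)
  moreover have "\<forall>\<^sub>F h in at_right 0. T t ((T h x - x) /\<^sub>R h) = (T h (T t x) - T t x) /\<^sub>R h"
    unfolding eventually_at_right_field using assms(2)
    by (intro exI[of _ 1]) (auto simp: blinfun.scaleR_right blinfun.diff_right T_commute)
  ultimately have "((\<lambda>h. (T h (T t x) - T t x) /\<^sub>R h) \<longlongrightarrow> T t z) (at_right 0)"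
    by (rule Lim_transform_eventually)
  then show ?thesis
    by (simp add: generator_def)
qed

lemma gen_scale:
  assumes "(x, z) \<in> gen"
  shows "(sc c x, sc c z) \<in> gen"
proof -
  have "((\<lambda>h. sc c ((T h x - x) /\<^sub>R h)) \<longlongrightarrow> sc c z) (at_right 0)"
    using assms by (intro bounded_linear.tendsto[OF bounded_linear_scale]) (simp add: generator_def)
  moreover have "\<forall>\<^sub>F h in at_right 0. sc c ((T h x - x) /\<^sub>R h) = (T h (sc c x) - sc c x) /\<^sub>R h"
    unfolding eventually_at_right_field
    by (intro exI[of _ 1]) (auto simp: scale_scaleR scale_right_diff_distrib T_scale)
  ultimately have "((\<lambda>h. (T h (sc c x) - sc c x) /\<^sub>R h) \<longlongrightarrow> sc c z) (at_right 0)"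
    by (rule Lim_transform_eventually)
  then show ?thesis
    by (simp add: generator_def)
qed

text \<open>
  The chain rule for \<open>\<phi>\<close>. As \<open>\<phi>\<close> is linear only on the sun dual, the rules for bounded linear
  maps do not apply.
\<close>

lemma sun_star_has_vector_derivative:
  assumes \<phi>: "\<phi> \<in> sun_star sc T"
    and u: "(u has_vector_derivative v) (at s within S)"
    and mem: "\<And>t. t \<in> S \<Longrightarrow> u t \<in> sun_dual sc T" "s \<in> S" "v \<in> sun_dual sc T"
  shows "((\<lambda>t. \<phi> (u t)) has_vector_derivative \<phi> v) (at s within S)"
  unfolding has_vector_derivative_def has_derivative_within_alt
proof (intro conjI allI impI)
  show "bounded_linear (\<lambda>h. h *\<^sub>R \<phi> v)"
    by (rule bounded_linear_scaleR_left)
  fix e :: real assume e: "0 < e"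
  define K where "K = subspace_dual_norm (sun_dual sc T) \<phi> + 1"
  have K: "K > 0" and le_K: "\<And>f. f \<in> sun_dual sc T \<Longrightarrow> norm (\<phi> f) \<le> K * norm f"
    using sun_star_norm_nonneg[OF \<phi>] order_trans[OF norm_sun_star_le[OF \<phi>] mult_right_mono]
    by (auto simp: K_def)
  have "\<forall>e>0. \<exists>d>0. \<forall>t\<in>S. norm (t - s) < d \<longrightarrow>
      norm (u t - u s - (t - s) *\<^sub>R v) \<le> e * norm (t - s)"
    using u by (simp add: has_vector_derivative_def has_derivative_within_alt)
  moreover have "0 < e / K"
    using e K by simp
  ultimately obtain d where d: "d > 0"
    "\<And>t. t \<in> S \<Longrightarrow> norm (t - s) < d \<Longrightarrow> norm (u t - u s - (t - s) *\<^sub>R v) \<le> e / K * norm (t - s)"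
    by meson
  show "\<exists>d>0. \<forall>t\<in>S. norm (t - s) < d \<longrightarrow>
      norm (\<phi> (u t) - \<phi> (u s) - (t - s) *\<^sub>R \<phi> v) \<le> e * norm (t - s)"
  proof (intro exI[of _ d] conjI ballI impI)
    fix t assume t: "t \<in> S" "norm (t - s) < d"
    have "\<phi> (u t) - \<phi> (u s) - (t - s) *\<^sub>R \<phi> v = \<phi> (u t - u s - (t - s) *\<^sub>R v)"
      using mem t by (simp add: sun_star_minus[OF \<phi>] sun_star_scaleR[OF \<phi>] diff_mem_sun_dual scaleR_mem_sun_dual)
    also have "norm \<dots> \<le> K * (e / K * norm (t - s))"
      using mem t d K by (intro order_trans[OF le_K] mult_left_mono diff_mem_sun_dual scaleR_mem_sun_dual) auto
    also have "\<dots> = e * norm (t - s)"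
      using K by simp
    finally show "norm (\<phi> (u t) - \<phi> (u s) - (t - s) *\<^sub>R \<phi> v) \<le> e * norm (t - s)" .
  qed fact
qed

section \<open>Norm continuity in the dual of the sun dual\<close>

lemma continuous_on_sun_star_orbit:
  assumes \<phi>: "\<phi> \<in> sun_star sc T" and f: "f \<in> sun_dual sc T" and a: "0 \<le> a"
  shows "continuous_on {a..b} (\<lambda>s. \<phi> (sun_semigroup T s f))"
proof -
  interpret S: Metric_space "sun_star sc T" "sun_star_dist sc T"
    by (rule Metric_space_sun_star)
  have "continuous_on {0..b} (\<lambda>\<tau>. \<phi> (sun_semigroup T (b - \<tau>) f))"
    using \<phi> f by (intro continuous_on_integrand[of UNIV]) (auto simp: sun_star_topology_def)
  then have "continuous_on {a..b} (\<lambda>s. \<phi> (sun_semigroup T (b - (b - s)) f))"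
    by (rule continuous_on_compose2) (use a in \<open>auto intro!: continuous_intros\<close>)
  then show ?thesis
    by simp
qed

lemma continuous_map_sun_starI:
  fixes f :: "real \<Rightarrow> ('a \<Rightarrow>\<^sub>L 'k) \<Rightarrow> 'k"
  assumes mem: "\<And>x. f x \<in> sun_star sc T"
    and lim: "\<And>x e. 0 < e \<Longrightarrow>
      \<exists>d>0. \<forall>y. \<bar>y - x\<bar> < d \<longrightarrow> subspace_dual_norm (sun_dual sc T) (f x - f y) < e"
  shows "continuous_map (top_of_set UNIV) (sun_star_topology sc T) f"
proof -
  interpret S: Metric_space "sun_star sc T" "sun_star_dist sc T"
    by (rule Metric_space_sun_star)
  show ?thesis
    unfolding sun_star_topology_def S.continuous_map_to_metric
  proof (intro ballI allI impI)
    fix x e :: real assume "0 < e"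
    then obtain d where d: "d > 0"
      "\<And>y. \<bar>y - x\<bar> < d \<Longrightarrow> subspace_dual_norm (sun_dual sc T) (f x - f y) < e"
      using lim by blast
    show "\<exists>U. openin (top_of_set UNIV) U \<and> x \<in> U \<and> (\<forall>y\<in>U. f y \<in> S.mball (f x) e)"
    proof (intro exI[of _ "ball x d"] conjI ballI)
      fix y assume "y \<in> ball x d"
      then show "f y \<in> S.mball (f x) e"
        using d(2)[of y] mem by (auto simp: sun_star_dist_def dist_real_def abs_minus_commute)
    qed (use d in auto)
  qed
qed

lemma sun_star_norm_fun_scale_le:
  assumes "\<phi> \<in> sun_star sc T"
  shows "subspace_dual_norm (sun_dual sc T) (fun_scale c \<phi>)
    \<le> norm c * subspace_dual_norm (sun_dual sc T) \<phi>"
  using assms by (intro sun_star_norm_leI)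
    (auto simp: fun_scale_def norm_mult intro!: mult_left_mono norm_sun_star_le_Sup)

end

section \<open>The resolvent and its adjoints\<close>

locale c0_semigroup_resolvent = c0_semigroup sc T
  for sc :: "'k::real_or_complex \<Rightarrow> 'a::banach \<Rightarrow> 'a" and T +
  fixes \<mu> :: 'k
  assumes resolvent_point: "\<mu> \<in> resolvent_set sc (generator UNIV (\<lambda>t. blinfun_apply (T t)))"
begin

definition R :: "'a \<Rightarrow>\<^sub>L 'a" where
  "R = Blinfun (resolvent sc gen \<mu>)"

lemma
  shows gen_resolvent: "(R y, sc \<mu> (R y) - y) \<in> gen"
    and resolvent_unique: "(x, z) \<in> gen \<Longrightarrow> R (sc \<mu> x - z) = x"
proof -
  have ex1: "\<exists>!x. \<exists>z. (x, z) \<in> gen \<and> sc \<mu> x - z = y" for y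
    using resolvent_point by (simp add: resolvent_set_def)
  have R: "blinfun_apply R = resolvent sc gen \<mu>"
    using resolvent_point by (simp add: R_def resolvent_set_def bounded_linear_Blinfun_apply)
  have "\<exists>z. (R y, z) \<in> gen \<and> sc \<mu> (R y) - z = y"
    using theI'[OF ex1[of y]] by (simp add: R resolvent_def)
  then show "(R y, sc \<mu> (R y) - y) \<in> gen"
    by (auto simp: algebra_simps)
  show "R (sc \<mu> x - z) = x" if "(x, z) \<in> gen"
    unfolding R resolvent_def using that by (intro the1_equality ex1) blast
qed

lemma resolvent_T: "0 \<le> t \<Longrightarrow> R (T t y) = T t (R y)"
  using resolvent_unique[OF gen_orbit[OF gen_resolvent[of y]], of t]
  by (simp add: blinfun.diff_right T_scale)

lemma resolvent_scale: "R (sc c y) = sc c (R y)"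
  using resolvent_unique[OF gen_scale[OF gen_resolvent[of y]], of c]
  by (simp add: scale_right_diff_distrib mult.commute[of c])

lemma comp_resolvent_mem_dual: "f \<in> dual sc \<Longrightarrow> f o\<^sub>L R \<in> dual sc"
  by (simp add: dual_def resolvent_scale)

text \<open>
  On the sun dual this is the generator of the sun semigroup applied to the resolvent, by the
  identity \<open>A R = \<mu> R - 1\<close>.
\<close>

definition gen_res :: "('a \<Rightarrow>\<^sub>L 'k) \<Rightarrow> ('a \<Rightarrow>\<^sub>L 'k)" where
  "gen_res f = dual_scale \<mu> (f o\<^sub>L R) - f"

lemma gen_res_apply: "f \<in> dual sc \<Longrightarrow> gen_res f x = f (sc \<mu> (R x) - x)"
  by (simp add: gen_res_def blinfun.diff_left dual_scale_apply blinfun.diff_right dual_def)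

lemma comp_resolvent_orbit_derivative:
  assumes f: "f \<in> dual sc" and s: "0 \<le> s"
  shows "((\<lambda>t. (f o\<^sub>L R) (T t x)) has_vector_derivative gen_res f (T s x)) (at s within {0..})"
proof (rule has_vector_derivative_transform_within)
  have "T s (sc \<mu> (R x) - x) = sc \<mu> (R (T s x)) - T s x"
    using s by (simp add: blinfun.diff_right T_scale resolvent_T)
  then show "((\<lambda>t. f (T t (R x))) has_vector_derivative gen_res f (T s x)) (at s within {0..})"
    using bounded_linear.has_vector_derivative[OF blinfun.bounded_linear_right
        orbit_has_vector_derivative[OF gen_resolvent s], of f x]
    by (simp add: gen_res_apply[OF f])
qed (use s in \<open>auto simp: resolvent_T intro: zero_less_one\<close>)

text \<open>
  Applied to a vector, the left-hand side is the linearization error of the scalar function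
  \<open>t \<mapsto> f (R (T t x))\<close>, which the mean value theorem bounds uniformly for \<open>x\<close> in the unit ball. This
  turns pointwise derivatives into derivatives in the operator norm.
\<close>

lemma comp_resolvent_linearization:
  assumes f: "f \<in> dual sc" and ab: "0 \<le> a" "0 \<le> b" and s: "s \<in> closed_segment a b"
    and B: "\<And>t. t \<in> closed_segment a b \<Longrightarrow> norm ((gen_res f o\<^sub>L T t) - (gen_res f o\<^sub>L T s)) \<le> B"
  shows "norm (((f o\<^sub>L R) o\<^sub>L T b) - ((f o\<^sub>L R) o\<^sub>L T a) - (b - a) *\<^sub>R (gen_res f o\<^sub>L T s)) \<le> norm (b - a) * B"
proof (rule norm_blinfun_bound)
  have sub: "closed_segment a b \<subseteq> {0..}"
    using ab by (auto simp: closed_segment_eq_real_ivl split: if_splits)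
  fix x
  have "norm ((f o\<^sub>L R) (T b x) - (f o\<^sub>L R) (T a x) - (b - a) *\<^sub>R gen_res f (T s x)) \<le> norm (b - a) * (B * norm x)"
  proof (rule vector_differentiable_bound_linearization)
    show "((\<lambda>t. (f o\<^sub>L R) (T t x)) has_vector_derivative gen_res f (T t x)) (at t within closed_segment a b)"
      if "t \<in> closed_segment a b" for t
      using that sub
      by (intro has_vector_derivative_within_subset[OF comp_resolvent_orbit_derivative] f) auto
    show "norm (gen_res f (T t x) - gen_res f (T s x)) \<le> B * norm x" if "t \<in> closed_segment a b" for t
      using norm_blinfun[of "(gen_res f o\<^sub>L T t) - (gen_res f o\<^sub>L T s)" x]
        mult_right_mono[OF B[OF that], of "norm x"]
      by (simp add: blinfun.diff_left)
  qed (use s in auto)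
  then show "norm (blinfun_apply (((f o\<^sub>L R) o\<^sub>L T b) - ((f o\<^sub>L R) o\<^sub>L T a) - (b - a) *\<^sub>R (gen_res f o\<^sub>L T s)) x)
      \<le> norm (b - a) * B * norm x"
    by (simp add: blinfun.diff_left blinfun.scaleR_left mult.assoc)
qed (use B[OF s] in simp)

text \<open>
  The derivative of \<open>t \<mapsto> f (R (T t x))\<close> is bounded on \<open>[0, 1]\<close>, uniformly for \<open>x\<close> in the unit ball, so
  \<open>t \<mapsto> f \<circ> R \<circ> T t\<close> is Lipschitz near \<open>0\<close> in norm, for every \<open>f\<close> in the dual.
\<close>

lemma comp_resolvent_mem_sun_dual:
  assumes f: "f \<in> dual sc"
  shows "f o\<^sub>L R \<in> sun_dual sc T"
proof -
  obtain M where M: "M > 0" "\<And>t. t \<in> {0..1} \<Longrightarrow> norm (T t) \<le> M"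
    using bounded_on_compact by blast
  define K where "K = norm (gen_res f) * M"
  have bound: "norm (gen_res f o\<^sub>L T t) \<le> K" if "0 \<le> t" "t \<le> 1" for t
    unfolding K_def using that M by (intro order_trans[OF norm_blinfun_compose] mult_left_mono) auto
  have le: "norm (((f o\<^sub>L R) o\<^sub>L T t) - (f o\<^sub>L R)) \<le> t * (3 * K)" if t: "0 < t" "t < 1" for t
  proof -
    have T0: "(f o\<^sub>L R) o\<^sub>L T 0 = f o\<^sub>L R"
      by (rule blinfun_eqI) (simp add: T_0)
    have "norm (((f o\<^sub>L R) o\<^sub>L T t) - ((f o\<^sub>L R) o\<^sub>L T 0) - (t - 0) *\<^sub>R (gen_res f o\<^sub>L T 0))
        \<le> norm (t - 0) * (2 * K)"
    proof (rule comp_resolvent_linearization)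
      fix s assume "s \<in> closed_segment 0 t"
      then have "0 \<le> s" "s \<le> 1"
        using t by (auto simp: closed_segment_eq_real_ivl)
      then show "norm ((gen_res f o\<^sub>L T s) - (gen_res f o\<^sub>L T 0)) \<le> 2 * K"
        using bound[of s] bound[of 0] norm_triangle_ineq4[of "gen_res f o\<^sub>L T s" "gen_res f o\<^sub>L T 0"] by simp
    qed (use t f in auto)
    then have "norm ((((f o\<^sub>L R) o\<^sub>L T t) - (f o\<^sub>L R)) - t *\<^sub>R (gen_res f o\<^sub>L T 0)) \<le> t * (2 * K)"
      using t by (simp add: T0)
    moreover have "norm (t *\<^sub>R (gen_res f o\<^sub>L T 0)) \<le> t * K"
      using t bound[of 0] by (simp add: mult_left_mono)
    ultimately show ?thesis
      using norm_triangle_sub[of "((f o\<^sub>L R) o\<^sub>L T t) - (f o\<^sub>L R)" "t *\<^sub>R (gen_res f o\<^sub>L T 0)"]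
      by (simp add: algebra_simps)
  qed
  have "((\<lambda>t. norm (((f o\<^sub>L R) o\<^sub>L T t) - (f o\<^sub>L R))) \<longlongrightarrow> 0) (at_right 0)"
  proof (rule tendsto_sandwich[OF _ _ tendsto_const])
    show "((\<lambda>t. t * (3 * K)) \<longlongrightarrow> 0) (at_right 0)"
      by (intro tendsto_mult_left_zero tendsto_ident_at)
    show "\<forall>\<^sub>F t in at_right 0. norm (((f o\<^sub>L R) o\<^sub>L T t) - (f o\<^sub>L R)) \<le> t * (3 * K)"
      unfolding eventually_at_right_field using le by (intro exI[of _ 1]) auto
  qed auto
  then show ?thesis
    by (simp add: sun_dual_def comp_resolvent_mem_dual f)
qed

lemma gen_res_mem_sun_dual: "f \<in> sun_dual sc T \<Longrightarrow> gen_res f \<in> sun_dual sc T"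
  unfolding gen_res_def
  by (intro diff_mem_sun_dual scale_mem_sun_dual comp_resolvent_mem_sun_dual sun_dual_in_dual)

text \<open>
  For \<open>f\<close> in the sun dual the derivative \<open>gen_res f \<circ> T t\<close> is continuous in norm, so the
  linearization error is small relative to the increment.
\<close>

lemma sun_resolvent_has_vector_derivative:
  assumes f: "f \<in> sun_dual sc T" and s: "0 \<le> s"
  shows "((\<lambda>t. sun_semigroup T t (f o\<^sub>L R)) has_vector_derivative sun_semigroup T s (gen_res f)) (at s within {0..})"
  unfolding has_vector_derivative_def has_derivative_within_alt
proof (intro conjI allI impI)
  show "bounded_linear (\<lambda>h. h *\<^sub>R sun_semigroup T s (gen_res f))"
    by (rule bounded_linear_scaleR_left)
  fix e :: real assume "0 < e"
  then obtain d where d: "d > 0" "\<And>t. 0 \<le> t \<Longrightarrow> dist t s < d \<Longrightarrow>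
      dist (sun_semigroup T t (gen_res f)) (sun_semigroup T s (gen_res f)) < e"
    using continuous_on_sun_semigroup[OF gen_res_mem_sun_dual[OF f]] s
    unfolding continuous_on_iff by (metis atLeast_iff)
  show "\<exists>d>0. \<forall>t\<in>{0..}. norm (t - s) < d \<longrightarrow>
      norm (sun_semigroup T t (f o\<^sub>L R) - sun_semigroup T s (f o\<^sub>L R) - (t - s) *\<^sub>R sun_semigroup T s (gen_res f))
        \<le> e * norm (t - s)"
  proof (intro exI[of _ d] conjI ballI impI)
    fix t :: real assume t: "t \<in> {0..}" "norm (t - s) < d"
    have "norm (sun_semigroup T t (f o\<^sub>L R) - sun_semigroup T s (f o\<^sub>L R) - (t - s) *\<^sub>R sun_semigroup T s (gen_res f))
        \<le> norm (t - s) * e"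
      unfolding sun_semigroup_def
    proof (rule comp_resolvent_linearization)
      fix r assume "r \<in> closed_segment s t"
      then have "0 \<le> r" "dist r s < d"
        using t s by (auto simp: closed_segment_eq_real_ivl dist_real_def split: if_splits)
      from d(2)[OF this] show "norm ((gen_res f o\<^sub>L T r) - (gen_res f o\<^sub>L T s)) \<le> e"
        by (simp add: sun_semigroup_def dist_norm)
    qed (use f s t in \<open>auto intro: sun_dual_in_dual\<close>)
    then show "norm (sun_semigroup T t (f o\<^sub>L R) - sun_semigroup T s (f o\<^sub>L R) - (t - s) *\<^sub>R sun_semigroup T s (gen_res f))
        \<le> e * norm (t - s)"
      by (simp add: mult.commute)
  qed fact
qed

abbreviation sun_gen :: "(('a \<Rightarrow>\<^sub>L 'k) \<times> ('a \<Rightarrow>\<^sub>L 'k)) set" where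
  "sun_gen \<equiv> generator (sun_dual sc T) (sun_semigroup T)"

lemma sun_gen_resolvent:
  assumes f: "f \<in> sun_dual sc T"
  shows "(f o\<^sub>L R, gen_res f) \<in> sun_gen"
proof -
  have "sun_semigroup T 0 g = g" for g :: "'a \<Rightarrow>\<^sub>L 'k"
    by (rule blinfun_eqI) (simp add: sun_semigroup_def T_0)
  then have "((\<lambda>h. (1 / norm (h - 0)) *\<^sub>R (sun_semigroup T h (f o\<^sub>L R) - ((f o\<^sub>L R) + (h - 0) *\<^sub>R gen_res f)))
      \<longlongrightarrow> 0) (at_right 0)"
    using sun_resolvent_has_vector_derivative[OF f, of 0]
    unfolding has_vector_derivative_def has_derivative_within by (simp add: at_within_Ici_at_right)
  from tendsto_add[OF this tendsto_const[of "gen_res f"]]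
  have "((\<lambda>h. (sun_semigroup T h (f o\<^sub>L R) - (f o\<^sub>L R)) /\<^sub>R h) \<longlongrightarrow> 0 + gen_res f) (at_right 0)"
  proof (rule Lim_transform_eventually)
    show "\<forall>\<^sub>F h in at_right 0.
        (1 / norm (h - 0)) *\<^sub>R (sun_semigroup T h (f o\<^sub>L R) - ((f o\<^sub>L R) + (h - 0) *\<^sub>R gen_res f)) + gen_res f
          = (sun_semigroup T h (f o\<^sub>L R) - (f o\<^sub>L R)) /\<^sub>R h"
      unfolding eventually_at_right_field
      by (intro exI[of _ 1]) (auto simp: scaleR_diff_right scaleR_add_right inverse_eq_divide)
  qed
  then show ?thesis
    using f by (simp add: generator_def comp_resolvent_mem_sun_dual gen_res_mem_sun_dual sun_dual_in_dual)
qed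

text \<open>
  The vectors \<open>R x\<close> lie in the domain of the generator, so there the difference quotients of the
  sun semigroup at \<open>f\<close> can be computed by moving them to \<open>T\<close>.
\<close>

lemma sun_gen_resolvent_unique:
  assumes "(f, g) \<in> sun_gen"
  shows "(dual_scale \<mu> f - g) o\<^sub>L R = f"
proof (rule blinfun_eqI)
  fix x
  have f: "f \<in> dual sc"
    using assms by (simp add: generator_def sun_dual_in_dual)
  have "((\<lambda>h. (sun_semigroup T h f - f) /\<^sub>R h) \<longlongrightarrow> g) (at_right 0)"
    using assms by (simp add: generator_def)
  then have "((\<lambda>h. blinfun_apply ((sun_semigroup T h f - f) /\<^sub>R h) (R x)) \<longlongrightarrow> g (R x)) (at_right 0)"
    by (intro tendsto_intros)
  moreover have "((\<lambda>h. f ((T h (R x) - R x) /\<^sub>R h)) \<longlongrightarrow> f (sc \<mu> (R x) - x)) (at_right 0)"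
    using gen_resolvent[of x] by (intro tendsto_intros) (simp add: generator_def)
  moreover have "blinfun_apply ((sun_semigroup T h f - f) /\<^sub>R h) (R x) = f ((T h (R x) - R x) /\<^sub>R h)" for h
    by (simp add: sun_semigroup_def blinfun.diff_left blinfun.diff_right blinfun.scaleR_left blinfun.scaleR_right)
  ultimately have "g (R x) = f (sc \<mu> (R x) - x)"
    using tendsto_unique[OF trivial_limit_at_right_real] by simp
  then show "blinfun_apply ((dual_scale \<mu> f - g) o\<^sub>L R) x = f x"
    using f by (simp add: blinfun.diff_left blinfun.diff_right dual_scale_apply dual_def)
qed

lemma sun_star_fun_scale: "\<phi> \<in> sun_star sc T \<Longrightarrow> fun_scale c \<phi> \<in> sun_star sc T"
proof -
  assume \<phi>: "\<phi> \<in> sun_star sc T"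
  obtain M where "\<And>f. f \<in> sun_dual sc T \<Longrightarrow> norm (\<phi> f) \<le> M * norm f"
    using sun_star_bound[OF \<phi>] by blast
  then have "\<forall>f\<in>sun_dual sc T. norm (fun_scale c \<phi> f) \<le> (norm c * M) * norm f"
    by (auto simp: fun_scale_def norm_mult mult.assoc intro!: mult_left_mono)
  then have "\<exists>M. \<forall>f\<in>sun_dual sc T. norm (fun_scale c \<phi> f) \<le> M * norm f"
    by blast
  then show ?thesis
    using \<phi> unfolding sun_star_def[of sc T] subspace_dual_def
    by (auto simp: fun_scale_def algebra_simps)
qed

text \<open>
  Existence: \<open>\<xi> = (f \<mapsto> \<phi> (f \<circ> R))\<close> solves \<open>\<mu> \<xi> - \<psi> = \<phi>\<close> with \<open>\<psi>\<close> the image of \<open>\<xi>\<close> under the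
  adjoint generator, because \<open>R\<close> is a left inverse (\<open>sun_gen_resolvent_unique\<close>). Uniqueness: testing
  any solution on the pairs \<open>(f \<circ> R, gen_res f)\<close> of \<open>sun_gen_resolvent\<close> determines its value at \<open>f\<close>.
\<close>

lemma resolvent_sun_star_generator:
  assumes \<phi>: "\<phi> \<in> sun_star sc T"
  shows "resolvent fun_scale (sun_star_generator sc T) \<mu> \<phi>
    = (\<lambda>f. if f \<in> sun_dual sc T then \<phi> (f o\<^sub>L R) else 0)"
proof -
  define \<xi> where "\<xi> = (\<lambda>f. if f \<in> sun_dual sc T then \<phi> (f o\<^sub>L R) else 0)"
  define \<psi> where "\<psi> = (\<lambda>f. \<mu> * \<xi> f - \<phi> f)"
  note V = comp_resolvent_mem_sun_dual[OF sun_dual_in_dual] gen_res_mem_sun_dual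
    scale_mem_sun_dual add_mem_sun_dual diff_mem_sun_dual
  have comp_scale: "dual_scale c f o\<^sub>L R = dual_scale c (f o\<^sub>L R)" for c f
    by (rule blinfun_eqI) (simp add: dual_scale_apply)
  have comp_add: "(f + g) o\<^sub>L R = (f o\<^sub>L R) + (g o\<^sub>L R)" for f g :: "'a \<Rightarrow>\<^sub>L 'k"
    by (rule blinfun_eqI) (simp add: blinfun.add_left)
  obtain M where M: "\<And>f. f \<in> sun_dual sc T \<Longrightarrow> norm (\<phi> f) \<le> M * norm f"
    using sun_star_bound[OF \<phi>] by blast
  have \<xi>_le: "norm (\<xi> f) \<le> (\<bar>M\<bar> * norm R) * norm f" if "f \<in> sun_dual sc T" for f
  proof -
    have "norm (\<xi> f) \<le> \<bar>M\<bar> * norm (f o\<^sub>L R)"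
      using M[OF V(1)[OF that]] that mult_right_mono[OF abs_ge_self[of M], of "norm (f o\<^sub>L R)"]
      by (simp add: \<xi>_def)
    also have "\<dots> \<le> \<bar>M\<bar> * (norm f * norm R)"
      by (intro mult_left_mono norm_blinfun_compose) simp
    finally show ?thesis
      by (simp add: mult_ac)
  qed
  have \<xi>: "\<xi> \<in> sun_star sc T"
    unfolding sun_star_def subspace_dual_def
  proof (intro CollectI conjI)
    show "\<exists>M. \<forall>f\<in>sun_dual sc T. norm (\<xi> f) \<le> M * norm f"
      using \<xi>_le by blast
  qed (use \<phi> in \<open>auto simp: \<xi>_def V comp_add comp_scale sun_star_add sun_star_scale\<close>)
  have "\<psi> = fun_scale \<mu> \<xi> - \<phi>"
    by (simp add: \<psi>_def fun_scale_def fun_eq_iff)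
  then have \<psi>: "\<psi> \<in> sun_star sc T"
    using \<phi> \<xi> by (simp add: sun_star_diff_mem sun_star_fun_scale)
  have "\<xi> g = \<psi> f" if fg: "(f, g) \<in> sun_gen" for f g
  proof -
    have mem: "f \<in> sun_dual sc T" "g \<in> sun_dual sc T"
      using fg by (simp_all add: generator_def)
    have "(dual_scale \<mu> f - g) o\<^sub>L R = dual_scale \<mu> (f o\<^sub>L R) - (g o\<^sub>L R)"
      by (rule blinfun_eqI) (simp add: blinfun.diff_left dual_scale_apply)
    with sun_gen_resolvent_unique[OF fg] have "g o\<^sub>L R = dual_scale \<mu> (f o\<^sub>L R) - f"
      by (simp add: algebra_simps)
    then show ?thesis
      using mem V \<phi> by (simp add: \<psi>_def \<xi>_def sun_star_minus sun_star_scale)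
  qed
  then have "(\<xi>, \<psi>) \<in> sun_star_generator sc T"
    using \<xi> \<psi> by (auto simp: sun_star_generator_def adjoint_graph_def sun_star_def)
  moreover have "fun_scale \<mu> \<xi> - \<psi> = \<phi>"
    by (simp add: fun_scale_def \<psi>_def fun_eq_iff)
  moreover have "\<xi>' = \<xi>"
    if "(\<xi>', \<psi>') \<in> sun_star_generator sc T" "fun_scale \<mu> \<xi>' - \<psi>' = \<phi>" for \<xi>' \<psi>'
  proof
    fix f
    have mem: "\<xi>' \<in> sun_star sc T" "\<psi>' \<in> sun_star sc T"
      and adj: "\<And>f g. (f, g) \<in> sun_gen \<Longrightarrow> \<xi>' g = \<psi>' f"
      using that(1) by (auto simp: sun_star_generator_def adjoint_graph_def sun_star_def)
    show "\<xi>' f = \<xi> f"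
    proof (cases "f \<in> sun_dual sc T")
      case True
      have "\<mu> * \<xi>' (f o\<^sub>L R) - \<xi>' f = \<xi>' (gen_res f)"
        using True mem V by (simp add: gen_res_def sun_star_minus sun_star_scale)
      also have "\<dots> = \<psi>' (f o\<^sub>L R)"
        by (rule adj[OF sun_gen_resolvent[OF True]])
      also have "\<dots> = \<mu> * \<xi>' (f o\<^sub>L R) - \<phi> (f o\<^sub>L R)"
        using fun_cong[OF that(2), of "f o\<^sub>L R"] by (simp add: fun_scale_def algebra_simps)
      finally show ?thesis
        using True by (simp add: \<xi>_def)
    qed (use mem in \<open>simp add: sun_star_off \<xi>_def\<close>)
  qed
  ultimately show ?thesis
    unfolding resolvent_def \<xi>_def[symmetric] by blast
qed

lemma range_sun_embed_iff:
  "(\<lambda>f. if f \<in> sun_dual sc T then F f else 0) \<in> range (sun_embed sc T) \<longleftrightarrow>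
    (\<exists>y. \<forall>f\<in>sun_dual sc T. F f = blinfun_apply f y)"
  by (auto simp: sun_embed_def fun_eq_iff image_iff)

lemma mem_sun_cross_iff:
  "\<phi> \<in> sun_cross sc T \<mu> \<longleftrightarrow>
    \<phi> \<in> sun_star sc T \<and> (\<exists>y. \<forall>f\<in>sun_dual sc T. \<phi> (f o\<^sub>L R) = blinfun_apply f y)"
  using resolvent_sun_star_generator[of \<phi>] range_sun_embed_iff[of "\<lambda>f. \<phi> (f o\<^sub>L R)"]
  by (cases "\<phi> \<in> sun_star sc T") (simp_all add: sun_cross_def)

lemma subspace_sun_cross: "module.subspace fun_scale (sun_cross sc T \<mu>)"
proof -
  interpret fs: vector_space "fun_scale :: 'k \<Rightarrow> (('a \<Rightarrow>\<^sub>L 'k) \<Rightarrow> 'k) \<Rightarrow> _"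
    by (rule vector_space_fun_scale)
  have zero: "0 \<in> sun_star sc T"
    by (auto simp: sun_star_def subspace_dual_def intro!: exI[of _ 0])
  show ?thesis
  proof (rule fs.subspaceI)
    show "0 \<in> sun_cross sc T \<mu>"
      using zero by (auto simp: mem_sun_cross_iff intro!: exI[of _ 0])
  next
    fix \<phi> \<psi> assume "\<phi> \<in> sun_cross sc T \<mu>" "\<psi> \<in> sun_cross sc T \<mu>"
    then obtain y z where *: "\<phi> \<in> sun_star sc T" "\<psi> \<in> sun_star sc T"
      "\<forall>f\<in>sun_dual sc T. \<phi> (f o\<^sub>L R) = blinfun_apply f y"
      "\<forall>f\<in>sun_dual sc T. \<psi> (f o\<^sub>L R) = blinfun_apply f z"
      by (auto simp: mem_sun_cross_iff)
    have "\<phi> - (0 - \<psi>) \<in> sun_star sc T"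
      using * zero by (intro sun_star_diff_mem)
    with * show "\<phi> + \<psi> \<in> sun_cross sc T \<mu>"
      by (auto simp: mem_sun_cross_iff blinfun.add_right intro!: exI[of _ "y + z"])
  next
    fix c \<phi> assume "\<phi> \<in> sun_cross sc T \<mu>"
    then obtain y where *: "\<phi> \<in> sun_star sc T"
      "\<forall>f\<in>sun_dual sc T. \<phi> (f o\<^sub>L R) = blinfun_apply f y"
      by (auto simp: mem_sun_cross_iff)
    have "fun_scale c \<phi> (f o\<^sub>L R) = f (sc c y)" if "f \<in> sun_dual sc T" for f
      using * sun_dual_in_dual[OF that] that by (simp add: fun_scale_def dual_def)
    with * show "fun_scale c \<phi> \<in> sun_cross sc T \<mu>"
      by (auto simp: mem_sun_cross_iff sun_star_fun_scale)
  qed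
qed

text \<open>
  If \<open>\<psi>\<close> in the cross space is close to \<open>\<phi>\<close>, then \<open>\<phi> (f \<circ> R)\<close> is close to \<open>\<psi> (f \<circ> R)\<close>, which is the value of \<open>f\<close> at
  a vector; so the claim reduces to \<open>sun_embed_closed\<close>.
\<close>

lemma closedin_sun_cross: "closedin (sun_star_topology sc T) (sun_cross sc T \<mu>)"
proof -
  interpret S: Metric_space "sun_star sc T" "sun_star_dist sc T"
    by (rule Metric_space_sun_star)
  let ?N = "subspace_dual_norm (sun_dual sc T)"
  have lim: "\<phi> \<in> sun_cross sc T \<mu>"
    if \<phi>: "\<phi> \<in> sun_star sc T" and near: "\<And>r. 0 < r \<Longrightarrow> \<not> disjnt (sun_cross sc T \<mu>) (S.mball \<phi> r)" for \<phi>
  proof -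
    have "\<exists>y. \<forall>f\<in>sun_dual sc T. norm (\<phi> (f o\<^sub>L R) - blinfun_apply f y) \<le> e * norm f" if e: "0 < e" for e
    proof -
      \<comment> \<open>The composition with \<open>R\<close> costs a factor \<open>norm R\<close>, which may be \<open>0\<close>.\<close>
      define r where "r = e / (norm R + 1)"
      have "0 < norm R + 1"
        by (simp add: add_nonneg_pos)
      then have r: "0 < r" "r * norm R \<le> e"
        using e by (auto simp: r_def divide_simps algebra_simps)
      obtain \<psi> where \<psi>: "\<psi> \<in> sun_cross sc T \<mu>" "\<psi> \<in> S.mball \<phi> r"
        using near[OF r(1)] by (auto simp: disjnt_iff)
      then have \<psi>_mem: "\<psi> \<in> sun_star sc T" and le: "?N (\<phi> - \<psi>) \<le> r"
        using \<phi> by (auto simp: sun_star_dist_def)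
      obtain y where y: "\<forall>f\<in>sun_dual sc T. \<psi> (f o\<^sub>L R) = blinfun_apply f y"
        using \<psi>(1) by (auto simp: mem_sun_cross_iff)
      have "norm (\<phi> (f o\<^sub>L R) - f y) \<le> e * norm f" if f: "f \<in> sun_dual sc T" for f
      proof -
        have "\<phi> (f o\<^sub>L R) - f y = (\<phi> - \<psi>) (f o\<^sub>L R)"
          using y f by simp
        also have "norm \<dots> \<le> ?N (\<phi> - \<psi>) * norm (f o\<^sub>L R)"
          using f by (intro norm_sun_star_le sun_star_diff_mem \<phi> \<psi>_mem comp_resolvent_mem_sun_dual sun_dual_in_dual)
        also have "\<dots> \<le> r * (norm f * norm R)"
          using r by (intro mult_mono le norm_blinfun_compose) auto
        also have "\<dots> \<le> e * norm f"
          using mult_right_mono[OF r(2), of "norm f"] by (simp add: mult_ac)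
        finally show ?thesis .
      qed
      then show ?thesis
        by blast
    qed
    from sun_embed_closed[OF this] show ?thesis
      using \<phi> by (simp add: mem_sun_cross_iff)
  qed
  show ?thesis
    unfolding sun_star_topology_def S.closedin_metric
  proof (intro conjI allI impI)
    show "sun_cross sc T \<mu> \<subseteq> sun_star sc T"
      by (auto simp: mem_sun_cross_iff)
    show "\<exists>r>0. disjnt (sun_cross sc T \<mu>) (S.mball \<phi> r)" if "\<phi> \<in> sun_star sc T - sun_cross sc T \<mu>" for \<phi>
      using lim[of \<phi>] that by blast
  qed
qed

lemma weak_star_integral_in_range_iff:
  "weak_star_integral (sun_dual sc T) s t (\<lambda>\<tau>. sun_star_semigroup sc T (t - \<tau>) (F \<tau>)) \<in> range (sun_embed sc T)
    \<longleftrightarrow> (\<exists>y. \<forall>f\<in>sun_dual sc T. integral {s..t} (\<lambda>\<tau>. F \<tau> (sun_semigroup T (t - \<tau>) f)) = blinfun_apply f y)"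
proof -
  have "weak_star_integral (sun_dual sc T) s t (\<lambda>\<tau>. sun_star_semigroup sc T (t - \<tau>) (F \<tau>))
      = (\<lambda>f. if f \<in> sun_dual sc T then integral {s..t} (\<lambda>\<tau>. F \<tau> (sun_semigroup T (t - \<tau>) f)) else 0)"
    by (auto simp: weak_star_integral_def sun_star_semigroup_def fun_eq_iff)
  then show ?thesis
    by (simp only: range_sun_embed_iff)
qed

section \<open>Admissibility of the cross space\<close>

text \<open>
  The derivative of \<open>f \<circ> R \<circ> T t\<close> is \<open>gen_res f \<circ> T t = \<mu> (f \<circ> R \<circ> T t) - f \<circ> T t\<close>: the orbit appears
  in its own derivative, and the remaining term is the orbit of \<open>f\<close>, over which admissibility integrates.
\<close>

lemma sun_star_resolvent_orbit:
  assumes \<phi>: "\<phi> \<in> sun_star sc T" and f: "f \<in> sun_dual sc T" and s: "0 \<le> s"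
  shows "((\<lambda>t. \<phi> (sun_semigroup T t (f o\<^sub>L R))) has_vector_derivative
    \<mu> * \<phi> (sun_semigroup T s (f o\<^sub>L R)) - \<phi> (sun_semigroup T s f)) (at s within {0..})"
proof -
  note V = sun_semigroup_mem_sun_dual comp_resolvent_mem_sun_dual[OF sun_dual_in_dual]
    gen_res_mem_sun_dual scale_mem_sun_dual
  have "sun_semigroup T s (gen_res f) = dual_scale \<mu> (sun_semigroup T s (f o\<^sub>L R)) - sun_semigroup T s f"
    by (rule blinfun_eqI) (simp add: gen_res_def sun_semigroup_def blinfun.diff_left dual_scale_apply)
  then have "\<phi> (sun_semigroup T s (gen_res f)) = \<mu> * \<phi> (sun_semigroup T s (f o\<^sub>L R)) - \<phi> (sun_semigroup T s f)"
    using \<phi> f s by (simp add: sun_star_minus sun_star_scale V)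
  moreover have "((\<lambda>t. \<phi> (sun_semigroup T t (f o\<^sub>L R))) has_vector_derivative
      \<phi> (sun_semigroup T s (gen_res f))) (at s within {0..})"
    using f s by (intro sun_star_has_vector_derivative \<phi> sun_resolvent_has_vector_derivative) (auto intro: V)
  ultimately show ?thesis
    by simp
qed

lemma sun_semigroup_resolvent:
  "0 \<le> s \<Longrightarrow> sun_semigroup T s (f o\<^sub>L R) = sun_semigroup T s f o\<^sub>L R"
  by (rule blinfun_eqI) (simp add: sun_semigroup_def resolvent_T)

text \<open>
  Along an orbit \<open>\<phi> (f \<circ> R \<circ> T s) = f (T s y)\<close>, so integrating the differential equation of
  \<open>sun_star_resolvent_orbit\<close> expresses the integral through \<open>f\<close> and the orbit of \<open>y\<close> only.
\<close>

lemma integral_constant_sun_cross: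
  assumes \<phi>: "\<phi> \<in> sun_cross sc T \<mu>" and ab: "0 \<le> a" "a \<le> b"
  shows "\<exists>y. \<forall>f\<in>sun_dual sc T. integral {a..b} (\<lambda>s. \<phi> (sun_semigroup T s f)) = blinfun_apply f y"
proof -
  obtain y where mem: "\<phi> \<in> sun_star sc T"
    and y: "\<And>f. f \<in> sun_dual sc T \<Longrightarrow> \<phi> (f o\<^sub>L R) = blinfun_apply f y"
    using \<phi> by (auto simp: mem_sun_cross_iff)
  define I where "I = integral {a..b} (\<lambda>s. T s y)"
  have "integral {a..b} (\<lambda>s. \<phi> (sun_semigroup T s f)) = f (sc \<mu> I - (T b y - T a y))"
    if f: "f \<in> sun_dual sc T" for f
  proof -
    have orbit: "\<phi> (sun_semigroup T s (f o\<^sub>L R)) = f (T s y)" if "0 \<le> s" for s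
      using y[OF sun_semigroup_mem_sun_dual[OF f that]] that
      by (simp add: sun_semigroup_resolvent) (simp add: sun_semigroup_def)
    have "((\<lambda>s. \<mu> * \<phi> (sun_semigroup T s (f o\<^sub>L R)) - \<phi> (sun_semigroup T s f)) has_integral
        \<phi> (sun_semigroup T b (f o\<^sub>L R)) - \<phi> (sun_semigroup T a (f o\<^sub>L R))) {a..b}"
      using ab by (intro fundamental_theorem_of_calculus
          has_vector_derivative_within_subset[OF sun_star_resolvent_orbit[OF mem f]]) auto
    then have "((\<lambda>s. \<mu> * f (T s y) - \<phi> (sun_semigroup T s f)) has_integral f (T b y) - f (T a y)) {a..b}"
      using ab orbit by (subst has_integral_cong[of "{a..b}" _
          "\<lambda>s. \<mu> * \<phi> (sun_semigroup T s (f o\<^sub>L R)) - \<phi> (sun_semigroup T s f)"]) auto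
    moreover have "((\<lambda>s. \<mu> * f (T s y)) has_integral \<mu> * f I) {a..b}"
      unfolding I_def
      using has_integral_linear[OF integrable_integral[OF integrable_orbit[OF ab(1), of y b]]
          bounded_linear_compose[OF bounded_linear_mult_right[of \<mu>] blinfun.bounded_linear_right[of f]]]
      by (simp add: o_def)
    ultimately have "((\<lambda>s. \<mu> * f (T s y) - (\<mu> * f (T s y) - \<phi> (sun_semigroup T s f))) has_integral
        \<mu> * f I - (f (T b y) - f (T a y))) {a..b}"
      by (rule has_integral_diff[rotated])
    then show ?thesis
      using f by (simp add: integral_unique blinfun.diff_right sun_dual_def dual_def)
  qed
  then show ?thesis
    by blast
qed

text \<open>
  Call an interval \<open>[a, b]\<close> good for \<open>e\<close> if the integral over it is an embedded vector up to an error
  \<open>e * (b - a)\<close>. Because the final time \<open>t\<close> stays fixed in the integrand, the integrals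
  and the errors over adjacent intervals simply add up, so concatenation preserves goodness. Near each
  point intervals are good because there \<open>F\<close> is almost constant. By bisection \<open>[s, t]\<close> is good for
  every \<open>e\<close>, and the range of the embedding is closed.
\<close>

lemma admissible_on_sun_cross: "admissible_on sc T UNIV (sun_cross sc T \<mu>)"
  unfolding admissible_on_def weak_star_integral_in_range_iff
proof (intro allI impI ballI)
  fix F :: "real \<Rightarrow> ('a \<Rightarrow>\<^sub>L 'k) \<Rightarrow> 'k" and s t :: real
  assume F: "continuous_map (top_of_set UNIV) (sun_star_topology sc T) F \<and> F ` UNIV \<subseteq> sun_cross sc T \<mu>"
    and st: "s \<le> t"
  let ?N = "subspace_dual_norm (sun_dual sc T)"
  let ?G = "\<lambda>f \<tau>. F \<tau> (sun_semigroup T (t - \<tau>) f)"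
  have F_mem: "F \<tau> \<in> sun_cross sc T \<mu>" "F \<tau> \<in> sun_star sc T" for \<tau>
    using F by (auto simp: mem_sun_cross_iff image_subset_iff)
  obtain M where M: "M > 0" "\<And>r. r \<in> {0..t - s} \<Longrightarrow> norm (T r) \<le> M"
    using bounded_on_compact by blast
  have cont: "continuous_on {a..b} (?G f)" if "f \<in> sun_dual sc T" "b \<le> t" for f a b
    using continuous_on_subset[OF continuous_on_integrand[of UNIV F a t f], of "{a..b}"] F that by auto
  define P where "P e a b \<longleftrightarrow> (s \<le> a \<and> b \<le> t \<longrightarrow>
    (\<exists>y. \<forall>f\<in>sun_dual sc T. norm (integral {a..b} (?G f) - blinfun_apply f y) \<le> e * (b - a) * norm f))"
    for e a b
  have "P e s t" if e: "0 < e" for e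
    using st
  proof (induction rule: Bolzano)
    case (trans a b c)
    show ?case
      unfolding P_def
    proof (intro impI)
      assume ac: "s \<le> a \<and> c \<le> t"
      obtain y where y: "\<And>f. f \<in> sun_dual sc T \<Longrightarrow>
          norm (integral {a..b} (?G f) - blinfun_apply f y) \<le> e * (b - a) * norm f"
        using trans ac unfolding P_def by force
      obtain z where z: "\<And>f. f \<in> sun_dual sc T \<Longrightarrow>
          norm (integral {b..c} (?G f) - blinfun_apply f z) \<le> e * (c - b) * norm f"
        using trans ac unfolding P_def by force
      have "norm (integral {a..c} (?G f) - f (y + z)) \<le> e * (c - a) * norm f"
        if f: "f \<in> sun_dual sc T" for f
      proof -
        have "integral {a..c} (?G f) = integral {a..b} (?G f) + integral {b..c} (?G f)"
          using trans ac cont[OF f, of c a]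
          by (intro Henstock_Kurzweil_Integration.integral_combine[symmetric] integrable_continuous_real) auto
        then have "integral {a..c} (?G f) - f (y + z)
            = (integral {a..b} (?G f) - f y) + (integral {b..c} (?G f) - f z)"
          by (simp add: blinfun.add_right)
        also have "norm \<dots> \<le> e * (b - a) * norm f + e * (c - b) * norm f"
          using y[OF f] z[OF f] by (intro order_trans[OF norm_triangle_ineq] add_mono)
        finally show ?thesis
          by (simp add: algebra_simps)
      qed
      then show "\<exists>y. \<forall>f\<in>sun_dual sc T. norm (integral {a..c} (?G f) - blinfun_apply f y) \<le> e * (c - a) * norm f"
        by blast
    qed
  next
    case (local x)
    have "0 < e / M"
      using e M by simp
    then obtain d where d: "d > 0" "\<And>\<tau>. \<bar>\<tau> - x\<bar> < d \<Longrightarrow> ?N (F x - F \<tau>) < e / M"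
      using continuous_map_sun_starD(2)[of UNIV F x "e / M"] F by auto
    show ?case
    proof (intro exI[of _ d] conjI allI impI)
      fix a b assume ab: "a \<le> x \<and> x \<le> b \<and> b - a < d"
      show "P e a b"
        unfolding P_def
      proof (intro impI)
        assume sub: "s \<le> a \<and> b \<le> t"
        obtain y where y: "\<And>f. f \<in> sun_dual sc T \<Longrightarrow>
            integral {t - b..t - a} (\<lambda>r. F x (sun_semigroup T r f)) = blinfun_apply f y"
          using integral_constant_sun_cross[OF F_mem(1), of "t - b" "t - a" x] ab sub by auto
        have "norm (integral {a..b} (?G f) - f y) \<le> e * (b - a) * norm f"
          if f: "f \<in> sun_dual sc T" for f
        proof -
          have mem: "sun_semigroup T (t - \<tau>) f \<in> sun_dual sc T" if "\<tau> \<in> {a..b}" for \<tau>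
            using f sub that by (intro sun_semigroup_mem_sun_dual) auto
          have cont_x: "continuous_on {a..b} (\<lambda>\<tau>. F x (sun_semigroup T (t - \<tau>) f))"
            using sub by (intro continuous_on_compose2[OF continuous_on_sun_star_orbit[OF F_mem(2)[of x] f order_refl, of "t - a"]])
              (auto intro!: continuous_intros)
          have "f y = integral {a..b} (\<lambda>\<tau>. F x (sun_semigroup T (t - \<tau>) f))"
            using y[OF f] integral_reverse_time[of a b "\<lambda>r. F x (sun_semigroup T r f)" t] by simp
          then have "integral {a..b} (?G f) - f y
              = integral {a..b} (\<lambda>\<tau>. ?G f \<tau> - F x (sun_semigroup T (t - \<tau>) f))"
            using sub cont[OF f] cont_x
            by (simp add: Henstock_Kurzweil_Integration.integral_diff integrable_continuous_real)
          also have "norm \<dots> \<le> e * norm f * (b - a)"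
          proof (rule integral_bound)
            show "continuous_on {a..b} (\<lambda>\<tau>. ?G f \<tau> - F x (sun_semigroup T (t - \<tau>) f))"
              using sub cont[OF f] cont_x by (intro continuous_on_diff) auto
            fix \<tau> assume \<tau>: "\<tau> \<in> {a..b}"
            have "norm (?G f \<tau> - F x (sun_semigroup T (t - \<tau>) f))
                = norm ((F x - F \<tau>) (sun_semigroup T (t - \<tau>) f))"
              by (simp add: norm_minus_commute)
            also have "\<dots> \<le> ?N (F x - F \<tau>) * norm (sun_semigroup T (t - \<tau>) f)"
              by (intro norm_sun_star_le sun_star_diff_mem F_mem mem \<tau>)
            also have "\<dots> \<le> e / M * (norm f * M)"
            proof (rule mult_mono)
              have "\<bar>\<tau> - x\<bar> < d"
                using \<tau> ab by auto
              then show "?N (F x - F \<tau>) \<le> e / M"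
                using d(2)[of \<tau>] by simp
              have "norm (T (t - \<tau>)) \<le> M"
                using \<tau> sub by (intro M) auto
              then show "norm (sun_semigroup T (t - \<tau>) f) \<le> norm f * M"
                unfolding sun_semigroup_def
                by (intro order_trans[OF norm_blinfun_compose] mult_left_mono) auto
            qed (use e M in auto)
            also have "\<dots> = e * norm f"
              using M by simp
            finally show "norm (?G f \<tau> - F x (sun_semigroup T (t - \<tau>) f)) \<le> e * norm f" .
          qed (use ab in auto)
          finally show ?thesis
            by (simp add: mult_ac)
        qed
        then show "\<exists>y. \<forall>f\<in>sun_dual sc T. norm (integral {a..b} (?G f) - blinfun_apply f y) \<le> e * (b - a) * norm f"
          by blast
      qed
    qed (use d in simp)
  qed
  then have P: "\<exists>y. \<forall>f\<in>sun_dual sc T. norm (integral {s..t} (?G f) - blinfun_apply f y) \<le> e * (t - s) * norm f"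
    if "0 < e" for e
    using that by (simp add: P_def)
  show "\<exists>y. \<forall>f\<in>sun_dual sc T. integral {s..t} (?G f) = blinfun_apply f y"
  proof (rule sun_embed_closed)
    fix e :: real assume e: "0 < e"
    then obtain y where y: "\<And>f. f \<in> sun_dual sc T \<Longrightarrow>
        norm (integral {s..t} (?G f) - blinfun_apply f y) \<le> e / (t - s + 1) * (t - s) * norm f"
      using P[of "e / (t - s + 1)"] st by auto
    moreover have "e / (t - s + 1) * (t - s) \<le> e"
      using st e by (simp add: field_simps)
    ultimately show "\<exists>y. \<forall>f\<in>sun_dual sc T. norm (integral {s..t} (?G f) - blinfun_apply f y) \<le> e * norm f"
      by (meson mult_right_mono norm_ge_zero order_trans)
  qed
qed

lemma admissible_range_sun_cross: "admissible_range sc T (sun_cross sc T \<mu>)"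
  unfolding admissible_range_def nondegenerate_interval_def
  using closedin_sun_cross subspace_sun_cross admissible_on_sun_cross
  by (intro conjI exI[of _ UNIV]) (auto intro: exI[of _ "0::real"] exI[of _ "1::real"])

section \<open>Maximality of the cross space\<close>

text \<open>
  Write \<open>h s = \<phi> (f \<circ> R \<circ> T s)\<close>. The weight \<open>1 - s\<close> vanishes at \<open>s = 1\<close>, so the integral of the
  derivative of \<open>(1 - s) * h s\<close> over \<open>[0, 1]\<close> is \<open>- h 0 = - \<phi> (f \<circ> R)\<close>, while its integrand contains
  only terms whose integrals admissibility turns into values of \<open>f\<close> and \<open>f \<circ> R\<close> at fixed vectors.
\<close>

lemma admissible_range_subset_sun_cross:
  assumes "admissible_range sc T W"
  shows "W \<subseteq> sun_cross sc T \<mu>"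
proof
  fix \<phi> assume \<phi>: "\<phi> \<in> W"
  interpret S: Metric_space "sun_star sc T" "sun_star_dist sc T"
    by (rule Metric_space_sun_star)
  interpret fs: vector_space "fun_scale :: 'k \<Rightarrow> (('a \<Rightarrow>\<^sub>L 'k) \<Rightarrow> 'k) \<Rightarrow> _"
    by (rule vector_space_fun_scale)
  have W: "closedin (sun_star_topology sc T) W" "fs.subspace W"
    and all: "\<And>J. nondegenerate_interval J \<Longrightarrow> admissible_on sc T J W"
    using assms by (auto simp: admissible_range_iff)
  have adm: "admissible_on sc T UNIV W"
    by (rule all) (auto simp: nondegenerate_interval_def intro: exI[of _ "0::real"] exI[of _ "1::real"])
  have mem: "\<phi> \<in> sun_star sc T"
    using closedin_subset[OF W(1)] \<phi> by (auto simp: sun_star_topology_def)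
  let ?N = "subspace_dual_norm (sun_dual sc T)"
  have N: "?N (fun_scale c \<phi>) \<le> norm c * ?N \<phi>" for c
    by (rule sun_star_norm_fun_scale_le[OF mem])
  have key: "\<exists>y. \<forall>f\<in>sun_dual sc T.
      integral {0..1} (\<lambda>s. of_real (\<alpha> + \<beta> * s) * \<phi> (sun_semigroup T s f)) = blinfun_apply f y" for \<alpha> \<beta> :: real
  proof -
    \<comment> \<open>Admissibility evaluates \<open>T\<close> at time \<open>1 - \<tau>\<close>, so the weight is written in that variable.\<close>
    define F where "F \<tau> = fun_scale (of_real (\<alpha> + \<beta> * (1 - \<tau>))) \<phi>" for \<tau>
    have "continuous_map (top_of_set UNIV) (sun_star_topology sc T) F"
    proof (rule continuous_map_sun_starI)
      show "F \<tau> \<in> sun_star sc T" for \<tau>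
        by (simp add: F_def sun_star_fun_scale mem)
      fix x e :: real assume e: "0 < e"
      define K where "K = \<bar>\<beta>\<bar> * ?N \<phi> + 1"
      have K: "0 < K"
        using sun_star_norm_nonneg[OF mem] by (simp add: K_def add_nonneg_pos)
      show "\<exists>d>0. \<forall>y. \<bar>y - x\<bar> < d \<longrightarrow> ?N (F x - F y) < e"
      proof (intro exI[of _ "e / K"] conjI allI impI)
        fix y assume y: "\<bar>y - x\<bar> < e / K"
        have "F x - F y = fun_scale (of_real (\<beta> * (y - x))) \<phi>"
          by (simp add: F_def fun_scale_def fun_eq_iff algebra_simps)
        then have "?N (F x - F y) \<le> \<bar>\<beta> * (y - x)\<bar> * ?N \<phi>"
          using N[of "of_real (\<beta> * (y - x))"] by (simp only: norm_of_real)
        also have "\<dots> = \<bar>y - x\<bar> * (\<bar>\<beta>\<bar> * ?N \<phi>)"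
          by (simp add: abs_mult mult_ac)
        also have "\<dots> \<le> \<bar>y - x\<bar> * K"
          by (intro mult_left_mono) (auto simp: K_def)
        also have "\<dots> < e"
          using y K by (simp add: field_simps)
        finally show "?N (F x - F y) < e" .
      qed (use e K in simp)
    qed
    moreover have "F ` UNIV \<subseteq> W"
      using fs.subspace_scale[OF W(2) \<phi>] by (auto simp: F_def)
    ultimately have "\<exists>y. \<forall>f\<in>sun_dual sc T.
        integral {0..1} (\<lambda>\<tau>. F \<tau> (sun_semigroup T (1 - \<tau>) f)) = blinfun_apply f y"
      using adm unfolding admissible_on_def weak_star_integral_in_range_iff by fastforce
    moreover have "integral {0..1} (\<lambda>\<tau>. F \<tau> (sun_semigroup T (1 - \<tau>) f))
        = integral {0..1} (\<lambda>s. of_real (\<alpha> + \<beta> * s) * \<phi> (sun_semigroup T s f))" for f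
      using integral_reverse_time[of 0 1 "\<lambda>s. of_real (\<alpha> + \<beta> * s) * \<phi> (sun_semigroup T s f)" 1]
      by (simp add: F_def fun_scale_def)
    ultimately show ?thesis
      by simp
  qed
  obtain c where c: "\<And>f. f \<in> sun_dual sc T \<Longrightarrow>
      integral {0..1} (\<lambda>s. \<phi> (sun_semigroup T s f)) = blinfun_apply f c"
    using key[of 1 0] by auto
  obtain d where d: "\<And>f. f \<in> sun_dual sc T \<Longrightarrow>
      integral {0..1} (\<lambda>s. (1 - s) *\<^sub>R \<phi> (sun_semigroup T s f)) = blinfun_apply f d"
    using key[of 1 "-1"] by (auto simp: scaleR_conv_of_real)
  have "\<phi> (f o\<^sub>L R) = f (R c + d - sc \<mu> (R d))" if f: "f \<in> sun_dual sc T" for f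
  proof -
    define g where "g = f o\<^sub>L R"
    have g: "g \<in> sun_dual sc T"
      unfolding g_def using f by (intro comp_resolvent_mem_sun_dual sun_dual_in_dual)
    let ?h = "\<lambda>f s. \<phi> (sun_semigroup T s f)"
    \<comment> \<open>Needed for \<open>u = f\<close> and for \<open>u = g\<close>: the derivative of \<open>?h g\<close> contains both orbits.\<close>
    have int: "(?h u has_integral blinfun_apply u c) {0..1}"
      "((\<lambda>s. (1 - s) *\<^sub>R ?h u s) has_integral blinfun_apply u d) {0..1}" if u: "u \<in> sun_dual sc T" for u
      unfolding c[OF u, symmetric] d[OF u, symmetric]
      by (intro integrable_integral integrable_continuous_real continuous_intros
          continuous_on_sun_star_orbit[OF mem u order_refl])+
    have "((\<lambda>s. (1 - s) *\<^sub>R (\<mu> * ?h g s - ?h f s) - ?h g s) has_integral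
        (1 - 1) *\<^sub>R ?h g 1 - (1 - 0) *\<^sub>R ?h g 0) {0..1}"
    proof (rule fundamental_theorem_of_calculus)
      fix s :: real assume s: "s \<in> {0..1}"
      have "(?h g has_vector_derivative \<mu> * ?h g s - ?h f s) (at s within {0..1})"
        unfolding g_def using s
        by (intro has_vector_derivative_within_subset[OF sun_star_resolvent_orbit[OF mem f]]) auto
      moreover have "((\<lambda>s. 1 - s) has_real_derivative - 1) (at s within {0..1})"
        by (auto intro!: derivative_eq_intros)
      ultimately show "((\<lambda>s. (1 - s) *\<^sub>R ?h g s) has_vector_derivative
          (1 - s) *\<^sub>R (\<mu> * ?h g s - ?h f s) - ?h g s) (at s within {0..1})"
        using has_vector_derivative_scaleR by fastforce
    qed simp
    moreover have "((\<lambda>s. (1 - s) *\<^sub>R (\<mu> * ?h g s - ?h f s) - ?h g s) has_integral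
        \<mu> * g d - f d - g c) {0..1}"
    proof -
      have "((\<lambda>s. \<mu> * ((1 - s) *\<^sub>R ?h g s) - (1 - s) *\<^sub>R ?h f s - ?h g s) has_integral
          \<mu> * g d - f d - g c) {0..1}"
        by (intro has_integral_diff has_integral_mult_right int f g)
      then show ?thesis
        by (simp add: scaleR_diff_right)
    qed
    ultimately have "(1 - 1) *\<^sub>R ?h g 1 - (1 - 0) *\<^sub>R ?h g 0 = \<mu> * g d - f d - g c"
      by (rule has_integral_unique)
    moreover have "sun_semigroup T 0 g = g"
      by (rule blinfun_eqI) (simp add: sun_semigroup_def T_0)
    ultimately have "- \<phi> g = \<mu> * g d - f d - g c"
      by simp
    then have "\<phi> g = g c + f d - \<mu> * g d"
      by (simp add: algebra_simps minus_equation_iff)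
    then show ?thesis
      using f by (simp add: g_def blinfun.add_right blinfun.diff_right sun_dual_def dual_def)
  qed
  with mem show "\<phi> \<in> sun_cross sc T \<mu>"
    unfolding mem_sun_cross_iff by blast
qed

end

theorem theorem13:
  fixes sc :: "'k::real_or_complex \<Rightarrow> 'a::banach \<Rightarrow> 'a"
    and T\<^sub>0 :: "real \<Rightarrow> 'a \<Rightarrow>\<^sub>L 'a"
    and \<mu> :: 'k
  assumes "c0_semigroup sc T\<^sub>0"
    and "\<mu> \<in> resolvent_set sc (generator UNIV (\<lambda>t. blinfun_apply (T\<^sub>0 t)))"
  shows "admissible_range sc T\<^sub>0 (sun_cross sc T\<^sub>0 \<mu>) \<and>
    (\<forall>W. admissible_range sc T\<^sub>0 W \<longrightarrow> W \<subseteq> sun_cross sc T\<^sub>0 \<mu>)"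
proof -
  interpret c0_semigroup_resolvent sc T\<^sub>0 \<mu>
    using assms by (simp add: c0_semigroup_resolvent_def c0_semigroup_resolvent_axioms_def)
  show ?thesis
    using admissible_range_sun_cross admissible_range_subset_sun_cross by blast
qed

end
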